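(* Let $\kappa\ge1$ and let $(R_{\ell,\ell'})_{\ell,\ell'\ge1}$ be a random array of $\kappa\times\kappa$ matrices which is a limit in distribution, along a subsequence, of the overlap arrays of the perturbed constrained Potts spin glass with non-random perturbation parameters $u^N$ for which the approximate Ghirlanda–Guerra identities hold asymptotically, as described in the context. Let $p,m\ge1$ be integers, $\lambda^1,\dots,\lambda^m\in[-1,1]^\kappa$, let $\varphi:\mathbb R^m\to\mathbb R$ be bounded and measurable, and set $$Q_{\ell,\ell'}=\varphi\Bigl(\bigl(R_{\ell,\ell'}^{\circ p}\lambda^1,\lambda^1\bigr),\dots,\bigl(R_{\ell,\ell'}^{\circ p}\lambda^m,\lambda^m\bigr)\Bigr).$$ Then for any $n\ge2$ and any bounded measurable function $f=f(R^n)$ of $R^n=(R_{\ell,\ell'})_{\ell,\ell'\le n}$, $$\mathbb E f(R^n)Q_{1,n+1}=\frac1n\,\mathbb E f(R^n)\,\mathbb E Q_{1,2}+\frac1n\sum_{\ell=2}^n\mathbb E f(R^n)Q_{1,\ell}.$$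
   Context: Notation. $A^{\circ p}$ is the entrywise $p$-th power of a matrix $A$; $(\cdot,\cdot)$ is the Euclidean scalar product. Constrained configurations. $\mathcal D=\{d\in\mathbb R^\kappa: d_k\ge0,\sum_kd_k=1\}$; $\Sigma_N(d)=\{\sigma\in\{1,\dots,\kappa\}^N:\sum_{i\le N}\mathrm I(\sigma_i=k)=Nd_k\ \forall k\le\kappa\}$; $\mathcal D_N=\{d\in\mathcal D:\Sigma_N(d)\ne\emptyset\}$. Fix $d^N\in\mathcal D_N$ for each $N$. Hamiltonian. $H_N(\sigma)=\frac1{\sqrt N}\sum_{i,j\le N}g_{ij}\mathrm I(\sigma_i=\sigma_j)$ with i.i.d. standard Gaussian $g_{ij}$. Perturbation. For $e=(i_1,\dots,i_p)\in\{1,\dots,N\}^p$ and $\lambda\in\mathbb R^\kappa$ let $S_\lambda(\sigma_e)=\sum_{k\le\kappa}\lambda_k\mathrm I(\sigma_{i_1}=k)\cdots\mathrm I(\sigma_{i_p}=k)$, and for $I=(e_1,\dots,e_n)\in(\{1,\dots,N\}^p)^n$ let $S_\lambda(\sigma_I)=S_\lambda(\sigma_{e_1})\cdots S_\lambda(\sigma_{e_n})$. Let $\Theta$ be the (countable) set of all $\theta=(p,m,n_1,\dots,n_m,\lambda^1,\dots,\lambda^m)$ with integers $p,m,n_j\ge1$ and $\lambda^j\in([-1,1]\cap\mathbb Q)^\kappa$. For $\theta\in\Theta$ let $$h_\theta(\sigma)=N^{-p(n_1+\dots+n_m)/2}\sum_{I_1,\dots,I_m}g_{I_1,\dots,I_m}S_{\lambda^1}(\sigma_{I_1})\cdots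 S_{\lambda^m}(\sigma_{I_m}),\quad I_j\in(\{1,\dots,N\}^p)^{n_j},$$ with standard Gaussian coefficients, all independent (also over $\theta$ and of $(g_{ij})$). Fix an injection $j_0:([-1,1]\cap\mathbb Q)^\kappa\to\mathbb N$ and let $j(\theta)=p+\sum_jn_j+\sum_jj_0(\lambda^j)+4m$. For $u=(u_\theta)\in[1,2]^\Theta$ let $h_N(\sigma)=\sum_{\theta\in\Theta}2^{-j(\theta)}u_\theta h_\theta(\sigma)$, and $H_N^{\rm pert}=H_N+s_Nh_N$ with $s_N=N^{a}$ for a fixed $a\in(1/4,1/2)$. Gibbs measure and overlaps. $G_N(\sigma)\propto\exp H_N^{\rm pert}(\sigma)$ on $\Sigma_N(d^N)$, with $u=u^N\in[1,2]^\Theta$ non-random; $\langle\cdot\rangle$ is the average with respect to $G_N^{\otimes\infty}$, $(\sigma^\ell)_{\ell\ge1}$ are i.i.d. replicas, $R_{\ell,\ell'}=(R_{\ell,\ell'}^{k,k'})_{k,k'\le\kappa}$ with $R_{\ell,\ell'}^{k,k'}=\frac1N\sum_{i\le N}\mathrm I(\sigma_i^\ell=k)\mathrm I(\sigma_i^{\ell'}=k')$, and for $\theta\in\Theta$, $C^\theta_{\ell,\ell'}=\prod_{j\le m}(R_{\ell,\ell'}^{\circ p}\lambda^j,\lambda^j)^{n_j}$. Assumption on $u^N$. For all $n\ge2$, all bounded measurable $f=f(R^n)$ and all $\theta\in\Theta$, $$\lim_{N\to\infty}\Bigl|\mathbb E\langle fC^\theta_{1,n+1}\rangle-\frac1n\mathbb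 E\langle f\rangle\,\mathbb E\langle C^\theta_{1,2}\rangle-\frac1n\sum_{\ell=2}^n\mathbb E\langle fC^\theta_{1,\ell}\rangle\Bigr|=0.$$ The array in the claim is a limit in distribution (in the sense of finite-dimensional distributions) of $(R_{\ell,\ell'})_{\ell,\ell'\ge1}$ under $\mathbb E G_N^{\otimes\infty}$ along some subsequence of $N$; the same notation is used for the limiting array. *)

theory Defs
  imports "HOL-Probability.Probability"
begin

text \<open>
  The number of states is \<open>\<kappa> = CARD('k)\<close>, the states being the elements of the finite type \<open>'k\<close>.
  Sites and replicas are numbered from 1. A configuration is an extensional function on \<open>{1..N}\<close>.
\<close>

definition state_simplex :: "(real ^ 'k::finite) set" where
  "state_simplex = {d. (\<forall>k. 0 \<le> d $ k) \<and> (\<Sum>k\<in>UNIV. d $ k) = 1}"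

definition constrained_configs :: "nat \<Rightarrow> real ^ 'k::finite \<Rightarrow> (nat \<Rightarrow> 'k) set" where
  "constrained_configs N d = {\<sigma> \<in> {1..N} \<rightarrow>\<^sub>E (UNIV :: 'k set).
     \<forall>k. (\<Sum>i\<in>{1..N}. of_bool (\<sigma> i = k)) = real N * d $ k}"

definition admissible_proportions :: "nat \<Rightarrow> (real ^ 'k::finite) set" where
  "admissible_proportions N = {d \<in> state_simplex. constrained_configs N d \<noteq> {}}"

text \<open>
  An element \<open>(p, [(n\<^sub>1,\<lambda>\<^sub>1), \<dots>, (n\<^sub>m,\<lambda>\<^sub>m)])\<close> encodes the index
  \<open>(p, m, n\<^sub>1, \<dots>, n\<^sub>m, \<lambda>\<^sub>1, \<dots>, \<lambda>\<^sub>m)\<close>; the number \<open>m\<close> is the length of the list.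
\<close>

type_synonym 'k pert_index = "nat \<times> (nat \<times> (real ^ 'k)) list"

definition rational_cube :: "(real ^ 'k::finite) set" where
  "rational_cube = {v. \<forall>k. v $ k \<in> \<rat> \<inter> {-1..1}}"

definition pert_indices :: "('k::finite) pert_index set" where
  "pert_indices = {(p, ws). p \<ge> 1 \<and> ws \<noteq> [] \<and> (\<forall>(n, v)\<in>set ws. n \<ge> 1 \<and> v \<in> rational_cube)}"

definition pert_rank :: "(real ^ 'k::finite \<Rightarrow> nat) \<Rightarrow> 'k pert_index \<Rightarrow> nat" where
  "pert_rank j0 = (\<lambda>(p, ws). p + (\<Sum>(n, v)\<leftarrow>ws. n) + (\<Sum>(n, v)\<leftarrow>ws. j0 v) + 4 * length ws)"

text \<open>
  \<open>multi_indices N (p, ws)\<close> is the set of all \<open>(I\<^sub>1, \<dots>, I\<^sub>m)\<close> with \<open>I\<^sub>j\<close> an \<open>n\<^sub>j\<close>-tuple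
  of \<open>p\<close>-tuples of sites; all tuples are lists.
\<close>

definition multi_indices :: "nat \<Rightarrow> ('k::finite) pert_index \<Rightarrow> nat list list list set" where
  "multi_indices N = (\<lambda>(p, ws). {Is. length Is = length ws \<and>
     (\<forall>j<length ws. length (Is ! j) = fst (ws ! j) \<and>
        (\<forall>e\<in>set (Is ! j). length e = p \<and> set e \<subseteq> {1..N}))})"

text \<open>
  Labels of the Gaussian coefficients: \<open>Bond i j\<close> for the coefficients of the Hamiltonian and
  \<open>Pert \<theta> [I\<^sub>1, \<dots>, I\<^sub>m]\<close> for those of the perturbation.
\<close>

datatype 'k coupling = Bond nat nat | Pert "('k::finite) pert_index" "nat list list list"

definition couplings :: "nat \<Rightarrow> ('k::finite) coupling set" where
  "couplings N = {Bond i j | i j. i \<in> {1..N} \<and> j \<in> {1..N}} \<union>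
     {Pert \<theta> Is | \<theta> Is. \<theta> \<in> pert_indices \<and> Is \<in> multi_indices N \<theta>}"

text \<open>Below, \<open>x\<close> is a realisation of the Gaussian coefficients.\<close>

definition potts_hamiltonian :: "nat \<Rightarrow> ('k::finite coupling \<Rightarrow> real) \<Rightarrow> (nat \<Rightarrow> 'k) \<Rightarrow> real" where
  "potts_hamiltonian N x \<sigma> =
     1 / sqrt (real N) * (\<Sum>i\<in>{1..N}. \<Sum>j\<in>{1..N}. x (Bond i j) * of_bool (\<sigma> i = \<sigma> j))"

definition S_edge :: "real ^ 'k::finite \<Rightarrow> (nat \<Rightarrow> 'k) \<Rightarrow> nat list \<Rightarrow> real" where
  "S_edge v \<sigma> e = (\<Sum>k\<in>UNIV. v $ k * (\<Prod>i\<leftarrow>e. of_bool (\<sigma> i = k)))"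

definition S_edges :: "real ^ 'k::finite \<Rightarrow> (nat \<Rightarrow> 'k) \<Rightarrow> nat list list \<Rightarrow> real" where
  "S_edges v \<sigma> I = (\<Prod>e\<leftarrow>I. S_edge v \<sigma> e)"

definition pert_term ::
  "nat \<Rightarrow> ('k::finite coupling \<Rightarrow> real) \<Rightarrow> 'k pert_index \<Rightarrow> (nat \<Rightarrow> 'k) \<Rightarrow> real" where
  "pert_term N x = (\<lambda>(p, ws) \<sigma>.
     real N powr (- (real p * real (\<Sum>(n, v)\<leftarrow>ws. n)) / 2) *
     (\<Sum>Is\<in>multi_indices N (p, ws).
        x (Pert (p, ws) Is) * (\<Prod>j<length ws. S_edges (snd (ws ! j)) \<sigma> (Is ! j))))"

definition perturbation ::
  "(real ^ 'k::finite \<Rightarrow> nat) \<Rightarrow> nat \<Rightarrow> ('k pert_index \<Rightarrow> real) \<Rightarrow> ('k coupling \<Rightarrow> real)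
    \<Rightarrow> (nat \<Rightarrow> 'k) \<Rightarrow> real" where
  "perturbation j0 N u x \<sigma> =
     (\<Sum>\<^sub>\<infinity>\<theta>\<in>pert_indices. (1 / 2) ^ pert_rank j0 \<theta> * u \<theta> * pert_term N x \<theta> \<sigma>)"

definition perturbed_hamiltonian ::
  "(real ^ 'k::finite \<Rightarrow> nat) \<Rightarrow> real \<Rightarrow> nat \<Rightarrow> ('k pert_index \<Rightarrow> real) \<Rightarrow> ('k coupling \<Rightarrow> real)
    \<Rightarrow> (nat \<Rightarrow> 'k) \<Rightarrow> real" where
  "perturbed_hamiltonian j0 a N u x \<sigma> =
     potts_hamiltonian N x \<sigma> + real N powr a * perturbation j0 N u x \<sigma>"

definition gibbs_measure ::
  "nat \<Rightarrow> real ^ 'k::finite \<Rightarrow> ((nat \<Rightarrow> 'k) \<Rightarrow> real) \<Rightarrow> (nat \<Rightarrow> 'k) measure" where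
  "gibbs_measure N d H = point_measure (constrained_configs N d)
     (\<lambda>\<sigma>. ennreal (exp (H \<sigma>) / (\<Sum>\<tau>\<in>constrained_configs N d. exp (H \<tau>))))"

text \<open>
  \<open>\<E>\<langle>F\<rangle>\<close> for the system of size \<open>N\<close>: the replicas \<open>(\<sigma>\<^sup>l)\<^sub>l\<^sub>\<ge>\<^sub>1\<close> are sampled from the infinite product
  of the Gibbs measure, and the result is averaged over the Gaussian coefficients \<open>g N\<close>.
\<close>

definition replica_mean ::
  "'w measure \<Rightarrow> (nat \<Rightarrow> 'k::finite coupling \<Rightarrow> 'w \<Rightarrow> real) \<Rightarrow> (real ^ 'k \<Rightarrow> nat) \<Rightarrow> real
    \<Rightarrow> (nat \<Rightarrow> real ^ 'k) \<Rightarrow> (nat \<Rightarrow> 'k pert_index \<Rightarrow> real)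
    \<Rightarrow> nat \<Rightarrow> ((nat \<Rightarrow> nat \<Rightarrow> 'k) \<Rightarrow> real) \<Rightarrow> real" where
  "replica_mean M g j0 a d u N F =
     (LINT \<omega>|M. LINT s|PiM {1..} (\<lambda>_. gibbs_measure N (d N)
        (perturbed_hamiltonian j0 a N (u N) (\<lambda>c. g N c \<omega>))). F s)"

definition overlap :: "nat \<Rightarrow> (nat \<Rightarrow> 'k::finite) \<Rightarrow> (nat \<Rightarrow> 'k) \<Rightarrow> real ^ 'k ^ 'k" where
  "overlap N \<sigma> \<tau> =
     (\<chi> k k'. 1 / real N * (\<Sum>i\<in>{1..N}. of_bool (\<sigma> i = k) * of_bool (\<tau> i = k')))"

definition overlap_array :: "nat \<Rightarrow> (nat \<Rightarrow> nat \<Rightarrow> 'k::finite) \<Rightarrow> nat \<times> nat \<Rightarrow> real ^ 'k ^ 'k" where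
  "overlap_array N s = (\<lambda>(l, l'). overlap N (s l) (s l'))"

definition hadamard_power :: "real ^ 'k::finite ^ 'k \<Rightarrow> nat \<Rightarrow> real ^ 'k ^ 'k" where
  "hadamard_power A p = (\<chi> k k'. (A $ k $ k') ^ p)"

definition hadamard_form :: "nat \<Rightarrow> real ^ 'k::finite ^ 'k \<Rightarrow> real ^ 'k \<Rightarrow> real" where
  "hadamard_form p A v = (hadamard_power A p *v v) \<bullet> v"

definition pert_covariance :: "('k::finite) pert_index \<Rightarrow> real ^ 'k ^ 'k \<Rightarrow> real" where
  "pert_covariance = (\<lambda>(p, ws) A. \<Prod>(n, v)\<leftarrow>ws. hadamard_form p A v ^ n)"

text \<open>
  Functions of \<open>R\<^sup>n\<close> are functions on the space of extensional families indexed by \<open>block n\<close>,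
  with the product sigma-algebra.
\<close>

definition block :: "nat \<Rightarrow> (nat \<times> nat) set" where
  "block n = {1..n} \<times> {1..n}"

definition bounded_measurable_block :: "nat \<Rightarrow> ((nat \<times> nat \<Rightarrow> real ^ 'k::finite ^ 'k) \<Rightarrow> real) \<Rightarrow> bool" where
  "bounded_measurable_block n f \<longleftrightarrow>
     f \<in> borel_measurable (PiM (block n) (\<lambda>_. borel)) \<and> bounded (f ` (block n \<rightarrow>\<^sub>E UNIV))"

text \<open>In the next two definitions \<open>E N F\<close> stands for \<open>\<E>\<langle>F\<rangle>\<close> in the system of size \<open>N\<close>.\<close>

definition approximate_Ghirlanda_Guerra ::
  "(nat \<Rightarrow> ((nat \<Rightarrow> nat \<Rightarrow> 'k::finite) \<Rightarrow> real) \<Rightarrow> real) \<Rightarrow> bool" where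
  "approximate_Ghirlanda_Guerra E \<longleftrightarrow>
     (\<forall>n\<ge>2. \<forall>f. bounded_measurable_block n f \<longrightarrow> (\<forall>\<theta>\<in>pert_indices.
        let F = (\<lambda>N s. f (restrict (overlap_array N s) (block n)));
            C = (\<lambda>N l l' s. pert_covariance \<theta> (overlap_array N s (l, l')))
        in (\<lambda>N. \<bar>E N (\<lambda>s. F N s * C N 1 (n + 1) s)
                 - 1 / real n * E N (F N) * E N (C N 1 2)
                 - 1 / real n * (\<Sum>l\<in>{2..n}. E N (\<lambda>s. F N s * C N 1 l s))\<bar>)
            \<longlonglongrightarrow> 0))"

text \<open>
  Convergence in distribution, in the sense of finite-dimensional distributions, of the overlap
  arrays along the subsequence \<open>r\<close> to the random array \<open>R\<close> on the probability space \<open>M'\<close>: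
  weak convergence of the laws of all finite subfamilies.
\<close>

definition overlap_limit ::
  "(nat \<Rightarrow> ((nat \<Rightarrow> nat \<Rightarrow> 'k::finite) \<Rightarrow> real) \<Rightarrow> real) \<Rightarrow> (nat \<Rightarrow> nat)
    \<Rightarrow> 'v measure \<Rightarrow> ('v \<Rightarrow> nat \<times> nat \<Rightarrow> real ^ 'k ^ 'k) \<Rightarrow> bool" where
  "overlap_limit E r M' R \<longleftrightarrow>
     (\<forall>J F. finite J \<longrightarrow> J \<subseteq> {1..} \<times> {1..} \<longrightarrow>
        continuous_map (product_topology (\<lambda>_. euclidean) J) euclideanreal F \<longrightarrow>
        bounded (F ` (J \<rightarrow>\<^sub>E UNIV)) \<longrightarrow>
        (\<lambda>t. E (r t) (\<lambda>s. F (restrict (overlap_array (r t) s) J)))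
          \<longlonglongrightarrow> (LINT y|M'. F (restrict (R y) J)))"

end

theory Submission
  imports Defs
begin

text \<open>
  Overlaps have entries in \<open>[0,1]\<close>, so clipping all matrix entries to \<open>[0,1]\<close> changes nothing before
  the limit and makes \<open>C\<^sup>\<theta>\<close> bounded and continuous. Weak convergence therefore carries the approximate
  identities over to the limit, first for \<open>f\<close> a product of continuous functions of the single overlaps.
  Each identity has the form \<open>\<Sum>\<^sub>i \<E> Z\<^sub>i h(X\<^sub>i) = 0\<close>, a condition linear in \<open>h\<close> and stable under bounded
  limits, which a monotone class argument extends from a \<open>\<pi>\<close>-system of closed sets to all bounded
  measurable \<open>h\<close>. It is used twice: with \<open>h = f\<close> and \<open>X = R\<^sup>n\<close>, and then, for \<open>f\<close> fixed, with
  \<open>h = \<phi>\<close> and \<open>X\<close> the vector of forms \<open>(R\<^sup>\<circ>\<^sup>p \<lambda>\<^sup>j, \<lambda>\<^sup>j)\<close>. In the second case the functions \<open>C\<^sup>\<theta>\<close> are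
  the monomials with rational \<open>\<lambda>\<^sup>j\<close>; density of the rationals and the Stone--Weierstrass theorem
  then give all continuous \<open>\<phi>\<close>.
\<close>

section \<open>Linear identities between expectations\<close>

text \<open>The weights \<open>Z\<close> carry coefficients and fixed factors, and the index set
  allows one test function \<open>h\<close> to be evaluated at several random points. With all terms
  moved to one side, an identity says that this quantity is 0. The first application has a one-point
  index set, the second has \<open>{1..n+1}\<close>.\<close>

definition weighted_mean ::
  "'a measure \<Rightarrow> 'i set \<Rightarrow> ('i \<Rightarrow> 'a \<Rightarrow> real) \<Rightarrow> ('i \<Rightarrow> 'a \<Rightarrow> 'b) \<Rightarrow> ('b \<Rightarrow> real) \<Rightarrow> real" where
  "weighted_mean M I Z X h = (\<Sum>i\<in>I. LINT y|M. Z i y * h (X i y))"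

locale weighted_variables =
  fixes M :: "'a measure" and N :: "'b measure" and I :: "'i set"
    and Z :: "'i \<Rightarrow> 'a \<Rightarrow> real" and X :: "'i \<Rightarrow> 'a \<Rightarrow> 'b"
  assumes finite_I: "finite I"
    and integrable_Z: "\<And>i. i \<in> I \<Longrightarrow> integrable M (Z i)"
    and measurable_X: "\<And>i. i \<in> I \<Longrightarrow> X i \<in> measurable M N"
begin

abbreviation mean :: "('b \<Rightarrow> real) \<Rightarrow> real" where
  "mean \<equiv> weighted_mean M I Z X"

lemma integrable_weighted:
  assumes i: "i \<in> I" and h: "h \<in> borel_measurable N" "\<And>x. x \<in> space N \<Longrightarrow> \<bar>h x\<bar> \<le> B"
  shows "integrable M (\<lambda>y. Z i y * h (X i y))"
proof (rule Bochner_Integration.integrable_bound)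
  note [measurable] = measurable_X[OF i] h(1) borel_measurable_integrable[OF integrable_Z[OF i]]
  show "integrable M (\<lambda>y. B * Z i y)"
    using integrable_Z[OF i] by simp
  show "(\<lambda>y. Z i y * h (X i y)) \<in> borel_measurable M"
    by measurable
  show "AE y in M. norm (Z i y * h (X i y)) \<le> norm (B * Z i y)"
  proof (rule AE_I2)
    fix y assume "y \<in> space M"
    then have "\<bar>h (X i y)\<bar> \<le> B"
      using h(2) measurable_space[OF measurable_X[OF i]] by blast
    then have "\<bar>h (X i y)\<bar> \<le> \<bar>B\<bar>"
      by linarith
    then show "norm (Z i y * h (X i y)) \<le> norm (B * Z i y)"
      by (metis abs_ge_zero abs_mult mult.commute mult_right_mono real_norm_def)
  qed
qed

lemma weighted_mean_cong:
  assumes "\<And>x. x \<in> space N \<Longrightarrow> h x = h' x"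
  shows "mean h = mean h'"
  unfolding weighted_mean_def
proof (intro sum.cong refl Bochner_Integration.integral_cong)
  fix i y assume "i \<in> I" "y \<in> space M"
  then show "Z i y * h (X i y) = Z i y * h' (X i y)"
    using assms measurable_space[OF measurable_X] by simp
qed

lemma weighted_mean_add:
  assumes "h \<in> borel_measurable N" "\<And>x. x \<in> space N \<Longrightarrow> \<bar>h x\<bar> \<le> B"
    and "h' \<in> borel_measurable N" "\<And>x. x \<in> space N \<Longrightarrow> \<bar>h' x\<bar> \<le> B'"
  shows "mean (\<lambda>x. h x + h' x) = mean h + mean h'"
  unfolding weighted_mean_def sum.distrib[symmetric]
  by (intro sum.cong refl, simp only: distrib_left)
    (intro Bochner_Integration.integral_add integrable_weighted[where B = B]
      integrable_weighted[where B = B'] assms)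

text \<open>A product that is not integrable has integral 0, so scalars move out for every
  \<open>h\<close>.\<close>

lemma weighted_mean_mult: "mean (\<lambda>x. c * h x) = c * mean h"
  by (simp add: weighted_mean_def sum_distrib_left mult.left_commute)

lemma weighted_mean_tendsto:
  assumes h: "\<And>t. h t \<in> borel_measurable N" "\<And>t x. x \<in> space N \<Longrightarrow> \<bar>h t x\<bar> \<le> B"
    and lim: "\<And>x. x \<in> space N \<Longrightarrow> (\<lambda>t. h t x) \<longlonglongrightarrow> k x"
  shows "(\<lambda>t. mean (h t)) \<longlonglongrightarrow> mean k"
  unfolding weighted_mean_def
proof (rule tendsto_sum)
  fix i assume i: "i \<in> I"
  note [measurable] = measurable_X[OF i] borel_measurable_integrable[OF integrable_Z[OF i]]
  have k[measurable]: "k \<in> borel_measurable N"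
    using h(1) lim by (rule borel_measurable_LIMSEQ_real[rotated])
  have X: "X i y \<in> space N" if "y \<in> space M" for y
    using measurable_space[OF measurable_X[OF i]] that .
  show "(\<lambda>t. LINT y|M. Z i y * h t (X i y)) \<longlonglongrightarrow> (LINT y|M. Z i y * k (X i y))"
  proof (rule integral_dominated_convergence[where w = "\<lambda>y. \<bar>Z i y\<bar> * B"])
    show "(\<lambda>y. Z i y * k (X i y)) \<in> borel_measurable M"
      by measurable
    show "(\<lambda>y. Z i y * h t (X i y)) \<in> borel_measurable M" for t
      using h(1)[of t] by measurable
    show "integrable M (\<lambda>y. \<bar>Z i y\<bar> * B)"
      using integrable_Z[OF i] by simp
    show "AE y in M. (\<lambda>t. Z i y * h t (X i y)) \<longlonglongrightarrow> Z i y * k (X i y)"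
      using X lim by (intro AE_I2 tendsto_mult tendsto_const) auto
    show "AE y in M. norm (Z i y * h t (X i y)) \<le> \<bar>Z i y\<bar> * B" for t
      using X h(2) by (intro AE_I2) (auto simp: abs_mult intro!: mult_left_mono)
  qed
qed

text \<open>The weights may change sign, so Dynkin's theorem is applied directly: the sets whose
  indicator has mean 0 are stable under complements, because the mean of 1 is 0, and under countable
  disjoint unions, by additivity and dominated convergence.\<close>

lemma weighted_mean_indicator_eq_0:
  assumes N: "sets N = sigma_sets (space N) G" and G: "Int_stable G"
    and one: "mean (\<lambda>_. 1) = 0"
    and ind: "\<And>A. A \<in> G \<Longrightarrow> mean (indicator A) = 0"
    and A: "A \<in> sets N"
  shows "mean (indicator A) = 0"
proof -
  have G_sub: "G \<subseteq> Pow (space N)"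
  proof
    fix A assume "A \<in> G"
    then have "A \<in> sets N"
      by (simp add: N)
    then show "A \<in> Pow (space N)"
      using sets.sets_into_space by blast
  qed
  from A have "A \<in> sigma_sets (space N) G"
    by (simp add: N)
  with G G_sub show ?thesis
  proof (induction rule: sigma_sets_induct_disjoint)
    case (basic A)
    then show ?case by (rule ind)
  next
    case empty
    show ?case
      by (simp add: weighted_mean_def)
  next
    case (compl A)
    have [measurable]: "A \<in> sets N"
      using compl.hyps by (simp add: N)
    have "mean (indicator (space N - A)) = mean (\<lambda>x. 1 + (- 1) * indicator A x)"
      by (rule weighted_mean_cong) (auto simp: indicator_def)
    also have "\<dots> = mean (\<lambda>_. 1) + mean (\<lambda>x. (- 1) * indicator A x)"
      by (rule weighted_mean_add[where B = 1 and B' = 1]) (auto simp: indicator_def)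
    also have "\<dots> = 0"
      using compl.IH one by (simp only: weighted_mean_mult)
    finally show ?case .
  next
    case (union A)
    have [measurable]: "A i \<in> sets N" for i
      using union.hyps by (auto simp: N)
    \<comment> \<open>Read as sums, the \<open>h t\<close> have mean 0 by additivity; read as
      indicators of finite unions, they are bounded by 1 and converge to the indicator of the whole
      union.\<close>
    define h where "h t x = (\<Sum>i<t. indicator (A i) x :: real)" for t :: nat and x
    have h_eq: "h t = indicator (\<Union>i<t. A i)" for t
      unfolding h_def fun_eq_iff
      by (subst indicator_UN_disjoint)
        (auto intro: disjoint_family_on_mono[OF _ union.hyps(1)])
    have "mean (h t) = 0" for t
    proof (induction t)
      case 0
      show ?case
        by (simp add: weighted_mean_def h_def)
    next
      case (Suc t)
      have "mean (h (Suc t)) = mean (\<lambda>x. h t x + indicator (A t) x)"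
        by (rule arg_cong[where f = mean]) (simp add: h_def fun_eq_iff)
      also have "\<dots> = mean (h t) + mean (indicator (A t))"
        by (rule weighted_mean_add[where B = 1 and B' = 1]) (auto simp: h_eq)
      finally show ?case
        using Suc union.IH by simp
    qed
    moreover have "(\<lambda>t. mean (h t)) \<longlonglongrightarrow> mean (indicator (\<Union>i. A i))"
      by (rule weighted_mean_tendsto[where B = 1])
        (auto simp: h_eq intro: LIMSEQ_indicator_UN)
    ultimately show ?case
      by (simp add: LIMSEQ_const_iff)
  qed
qed

text \<open>Indicators of all measurable sets have mean 0 by the preceding lemma; nonnegative
  functions are built from them by scaling, addition and increasing limits, and a shift by a
  constant handles a bounded \<open>h\<close> of either sign.\<close>

lemma weighted_mean_eq_0:
  fixes h :: "'b \<Rightarrow> real"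
  assumes N: "sets N = sigma_sets (space N) G" and G: "Int_stable G"
    and one: "mean (\<lambda>_. 1) = 0"
    and ind: "\<And>A. A \<in> G \<Longrightarrow> mean (indicator A) = 0"
    and h: "h \<in> borel_measurable N" "bounded (h ` space N)"
  shows "mean h = 0"
proof -
  obtain B where B: "\<And>x. x \<in> space N \<Longrightarrow> \<bar>h x\<bar> \<le> B"
    using h(2) by (auto simp: bounded_iff)
  \<comment> \<open>The induction rule treats functions that are nonnegative everywhere, whereas
    \<open>h\<close> is controlled only on the space; hence the shift by \<open>B\<close> there and
    the value 0 elsewhere.\<close>
  define h' where "h' x = (if x \<in> space N then h x + B else 0)" for x
  have h'_meas: "h' \<in> borel_measurable N"
    unfolding h'_def by (subst measurable_cong[where g = "\<lambda>x. h x + B"]) (use h(1) in auto)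
  have h'_pos: "0 \<le> h' x" for x
    using B[of x] by (auto simp: h'_def)
  have h'_bound: "x \<in> space N \<Longrightarrow> \<bar>h' x\<bar> \<le> 2 * B" for x
    using B[of x] by (auto simp: h'_def)
  \<comment> \<open>Boundedness is kept as a premise of the induction claim, since unbounded
    functions may have no meaningful mean. Nonnegativity makes every summand and every member of an
    increasing sequence inherit the bound of the sum or limit.\<close>
  have nonneg: "(\<exists>B. \<forall>x\<in>space N. k x \<le> B) \<longrightarrow> mean k = 0"
    if "k \<in> borel_measurable N" "\<And>x. 0 \<le> k x" for k
    using that
  proof (induction rule: borel_measurable_induct_real)
    case (set A)
    then show ?case
      using weighted_mean_indicator_eq_0[OF N G one ind] by blast
  next
    case (mult k c)
    show ?case
    \<comment> \<open>A bound of \<open>c * k\<close> yields one of \<open>k\<close> only if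
      \<open>c\<close> is nonzero; for \<open>c = 0\<close> the mean vanishes without the induction
      hypothesis.\<close>
    proof (cases "c = 0")
      case True
      then show ?thesis by (simp add: weighted_mean_def)
    next
      case False
      show ?thesis
      proof
        assume "\<exists>B. \<forall>x\<in>space N. c * k x \<le> B"
        then obtain B where "\<And>x. x \<in> space N \<Longrightarrow> c * k x \<le> B"
          by blast
        then have "\<And>x. x \<in> space N \<Longrightarrow> k x \<le> B / c"
          using mult False by (simp add: field_simps)
        then show "mean (\<lambda>x. c * k x) = 0"
          using mult by (auto simp: weighted_mean_mult)
      qed
    qed
  next
    case (add k k')
    show ?case
    proof
      assume "\<exists>B. \<forall>x\<in>space N. k' x + k x \<le> B"
      then obtain B where B: "\<And>x. x \<in> space N \<Longrightarrow> k' x + k x \<le> B"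
        by blast
      have bd: "\<bar>k x\<bar> \<le> B" "\<bar>k' x\<bar> \<le> B" if "x \<in> space N" for x
        using B[OF that] add(2,4)[of x] by linarith+
      have "mean (\<lambda>x. k' x + k x) = mean k' + mean k"
        by (rule weighted_mean_add) (use add bd in auto)
      moreover have "mean k = 0"
        using add bd(1) by (meson abs_le_D1)
      moreover have "mean k' = 0"
        using add bd(2) by (meson abs_le_D1)
      ultimately show "mean (\<lambda>x. k' x + k x) = 0"
        by simp
    qed
  next
    case (seq U)
    show ?case
    proof
      assume "\<exists>B. \<forall>x\<in>space N. k x \<le> B"
      then obtain B where B: "\<And>x. x \<in> space N \<Longrightarrow> k x \<le> B"
        by blast
      have le: "U i x \<le> k x" if "x \<in> space N" for i x
        by (rule incseq_le) (use seq that in \<open>auto simp: incseq_def le_fun_def\<close>)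
      have bd: "\<bar>U i x\<bar> \<le> B" if "x \<in> space N" for i x
        using le[OF that, of i] B[OF that] seq(2)[of i x] by linarith
      have "mean (U i) = 0" for i
        using seq(5)[of i] bd by (meson abs_le_D1)
      moreover have "(\<lambda>i. mean (U i)) \<longlonglongrightarrow> mean k"
        by (rule weighted_mean_tendsto[OF _ bd]) (use seq in auto)
      ultimately show "mean k = 0"
        by (simp add: LIMSEQ_const_iff)
    qed
  qed
  have "mean h = mean (\<lambda>x. h' x + (- B) * 1)"
    by (rule weighted_mean_cong) (simp add: h'_def)
  also have "\<dots> = mean h' + mean (\<lambda>x. (- B) * 1)"
    by (rule weighted_mean_add[OF h'_meas h'_bound, where B' = "\<bar>B\<bar>"]) auto
  also have "\<dots> = 0"
    using nonneg[OF h'_meas h'_pos] h'_bound one unfolding weighted_mean_mult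
    by (metis abs_le_D1 add.right_neutral mult_zero_right)
  finally show ?thesis .
qed

end

section \<open>Continuous approximation of closed sets and closed boxes\<close>

definition closed_approx :: "'a::metric_space set \<Rightarrow> nat \<Rightarrow> 'a \<Rightarrow> real" where
  "closed_approx C t x = (if C = {} then 0 else max 0 (1 - real t * infdist x C))"

lemma closed_approx_bounds: "0 \<le> closed_approx C t x" "closed_approx C t x \<le> 1"
  by (auto simp: closed_approx_def infdist_nonneg)

lemma continuous_closed_approx: "continuous_on S (closed_approx C t)"
  by (cases "C = {}") (auto simp: closed_approx_def [abs_def] intro!: continuous_intros)

text \<open>Closedness makes \<open>infdist x C\<close> positive off \<open>C\<close>, so the value
  is 0 once \<open>t\<close> exceeds its reciprocal. The empty set has a separate clause in
  \<open>closed_approx\<close> because \<open>infdist x {}\<close> is 0 by convention, which would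
  give the value 1.\<close>

lemma closed_approx_tendsto:
  assumes "closed C"
  shows "(\<lambda>t. closed_approx C t x) \<longlonglongrightarrow> indicator C x"
proof (cases "x \<in> C")
  case True
  then show ?thesis
    by (cases "C = {}") (auto simp: closed_approx_def)
next
  case False
  show ?thesis
  proof (cases "C = {}")
    case True
    then show ?thesis by (simp add: closed_approx_def)
  next
    case ne: False
    then have pos: "infdist x C > 0"
      using assms False by (metis in_closed_iff_infdist_zero infdist_nonneg order_less_le)
    obtain t0 :: nat where "1 / infdist x C < real t0"
      using reals_Archimedean2 by blast
    then have "closed_approx C t x = 0" if "t \<ge> t0" for t
    proof -
      have "1 / infdist x C < real t"
        using \<open>1 / infdist x C < real t0\<close> that by linarith
      then show ?thesis
        using pos ne by (simp add: closed_approx_def field_simps)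
    qed
    then have "eventually (\<lambda>t. closed_approx C t x = indicator C x) sequentially"
      using False by (auto simp: eventually_sequentially)
    then show ?thesis
      by (rule tendsto_eventually)
  qed
qed

text \<open>Closed sets form a \<pi>-system generating the Borel sets, and their indicators are
  bounded limits of continuous functions.\<close>

lemma weighted_mean_borel_eq_0:
  fixes h :: "'b::metric_space \<Rightarrow> real"
  assumes "weighted_variables M (borel :: 'b measure) I Z X"
    and cont: "\<And>k. continuous_on UNIV k \<Longrightarrow> bounded (range k) \<Longrightarrow> weighted_mean M I Z X k = 0"
    and h: "h \<in> borel_measurable borel" "bounded (range h)"
  shows "weighted_mean M I Z X h = 0"
proof -
  interpret weighted_variables M "borel :: 'b measure" I Z X
    by fact
  show ?thesis
  proof (rule weighted_mean_eq_0[where G = "Collect closed"])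
    show "sets borel = sigma_sets (space borel) (Collect (closed :: 'b set \<Rightarrow> bool))"
      by (subst borel_eq_closed) simp
    show "Int_stable (Collect (closed :: 'b set \<Rightarrow> bool))"
      by (auto simp: Int_stable_def)
    show "mean (\<lambda>_. 1) = 0"
      by (rule cont) auto
    show "mean (indicator A) = 0" if "A \<in> Collect closed" for A
    proof -
      have "(\<lambda>t. mean (closed_approx A t)) \<longlonglongrightarrow> mean (indicator A)"
        by (rule weighted_mean_tendsto[where B = 1])
          (use that closed_approx_bounds[of A] in \<open>auto simp: closed_approx_tendsto
            intro!: borel_measurable_continuous_onI continuous_closed_approx\<close>)
      moreover have "mean (closed_approx A t) = 0" for t
        by (rule cont[OF continuous_closed_approx])
          (use closed_approx_bounds[of A] in \<open>auto simp: bounded_iff intro!: exI[of _ 1]\<close>)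
      ultimately show ?thesis
        by (simp add: LIMSEQ_const_iff)
    qed
  qed (use h in auto)
qed

lemma sets_PiM_borel_closed:
  assumes "finite J"
  shows "sets (PiM J (\<lambda>_. borel :: 'b::topological_space measure)) =
    sigma_sets (J \<rightarrow>\<^sub>E UNIV) {PiE J A | A. \<forall>b\<in>J. closed (A b)}"
proof -
  have "sets (PiM J (\<lambda>_. borel :: 'b measure)) =
      sets (PiM J (\<lambda>_. sigma UNIV (Collect (closed :: 'b set \<Rightarrow> bool))))"
    by (simp only: borel_eq_closed)
  \<comment> \<open>Since \<open>J\<close> is finite, a single block \<open>{J}\<close> of
    coordinates suffices. The rule also asks for a countable cover of each factor by generators;
    \<open>UNIV\<close> is closed, so \<open>{UNIV}\<close> is one.\<close>
  also have "\<dots> = sets (sigma (J \<rightarrow>\<^sub>E UNIV)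
      {{f \<in> J \<rightarrow>\<^sub>E UNIV. \<forall>i\<in>j. f i \<in> A i} | A j. j \<in> {J} \<and> A \<in> Pi j (\<lambda>_. Collect closed)})"
    by (rule sets_PiM_sigma) (use assms in \<open>auto intro!: exI[of _ "{UNIV}"]\<close>)
  also have "\<dots> = sigma_sets (J \<rightarrow>\<^sub>E UNIV)
      {{f \<in> J \<rightarrow>\<^sub>E UNIV. \<forall>i\<in>j. f i \<in> A i} | A j. j \<in> {J} \<and> A \<in> Pi j (\<lambda>_. Collect closed)}"
    by (rule sets_measure_of) auto
  also have "{{f \<in> J \<rightarrow>\<^sub>E UNIV. \<forall>i\<in>j. f i \<in> A i} | A j. j \<in> {J} \<and> A \<in> Pi j (\<lambda>_. Collect closed)} =
      {PiE J A | A. \<forall>b\<in>J. closed (A b :: 'b set)}"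
  proof -
    have eq: "{f \<in> J \<rightarrow>\<^sub>E UNIV. \<forall>i\<in>J. f i \<in> A i} = PiE J A" for A :: "_ \<Rightarrow> 'b set"
      by (auto simp: PiE_def)
    show ?thesis
      by (simp add: eq Pi_iff)
  qed
  finally show ?thesis .
qed

text \<open>Closed boxes form a generating \<pi>-system of the finite product, and the indicator of
  a box is a bounded limit of products of continuous functions of single coordinates. Test functions
  of product form are therefore enough.\<close>

lemma weighted_mean_PiM_borel_eq_0:
  fixes h :: "('c \<Rightarrow> 'd::{metric_space, second_countable_topology}) \<Rightarrow> real"
  assumes "weighted_variables M (PiM J (\<lambda>_. borel)) I Z X" and "finite J"
    and cont: "\<And>k. (\<And>b. continuous_on UNIV (k b)) \<Longrightarrow> (\<And>b x. k b x \<in> {0..1}) \<Longrightarrow>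
      weighted_mean M I Z X (\<lambda>x. \<Prod>b\<in>J. k b (x b)) = 0"
    and h: "h \<in> borel_measurable (PiM J (\<lambda>_. borel))" "bounded (h ` (J \<rightarrow>\<^sub>E UNIV))"
  shows "weighted_mean M I Z X h = 0"
proof -
  interpret weighted_variables M "PiM J (\<lambda>_. borel) :: ('c \<Rightarrow> 'd) measure" I Z X
    by fact
  let ?G = "{PiE J A | A. \<forall>b\<in>J. closed (A b :: 'd set)}"
  show ?thesis
  proof (rule weighted_mean_eq_0[where G = ?G])
    show "sets (PiM J (\<lambda>_. borel)) = sigma_sets (space (PiM J (\<lambda>_. borel :: 'd measure))) ?G"
      using sets_PiM_borel_closed[OF \<open>finite J\<close>] by (simp add: space_PiM)
    show "Int_stable ?G"
    proof (rule Int_stableI)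
      fix S T assume "S \<in> ?G" "T \<in> ?G"
      then obtain A B where "S = PiE J A" "T = PiE J B" "\<forall>b\<in>J. closed (A b)" "\<forall>b\<in>J. closed (B b)"
        by blast
      then show "S \<inter> T \<in> ?G"
        by (auto simp: PiE_Int intro!: exI[of _ "\<lambda>b. A b \<inter> B b"])
    qed
    show "mean (\<lambda>_. 1) = 0"
      using cont[of "\<lambda>_ _. 1"] by simp
    show "mean (indicator S) = 0" if "S \<in> ?G" for S
    proof -
      from that obtain A where S: "S = PiE J A" and A: "\<And>b. b \<in> J \<Longrightarrow> closed (A b)"
        by blast
      let ?k = "\<lambda>t x. \<Prod>b\<in>J. closed_approx (A b) t (x b)"
      have "(\<lambda>t. mean (?k t)) \<longlonglongrightarrow> mean (indicator S)"
      proof (rule weighted_mean_tendsto[where B = 1])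
        have [measurable]: "closed_approx (A b) t \<in> borel_measurable borel" for b t
          by (intro borel_measurable_continuous_onI continuous_closed_approx)
        show "?k t \<in> borel_measurable (PiM J (\<lambda>_. borel))" for t
          by measurable
        show "\<bar>?k t x\<bar> \<le> 1" for t x
          by (auto simp: abs_prod closed_approx_bounds intro!: prod_le_1)
        fix x :: "'c \<Rightarrow> 'd" assume "x \<in> space (PiM J (\<lambda>_. borel))"
        then have x: "x \<in> J \<rightarrow>\<^sub>E UNIV"
          by (simp add: space_PiM)
        \<comment> \<open>The factorisation relies on \<open>x\<close> being extensional: membership
          in \<open>PiE J A\<close> also prescribes the values outside \<open>J\<close>.\<close>
        have "(\<Prod>b\<in>J. indicator (A b) (x b)) = (indicator S x :: real)"
        proof (cases "x \<in> S")
          case True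
          then show ?thesis
            by (auto simp: S PiE_iff intro!: prod.neutral)
        next
          case False
          then show ?thesis
            using x \<open>finite J\<close> by (auto simp: S PiE_iff indicator_eq_0_iff)
        qed
        moreover have "(\<lambda>t. ?k t x) \<longlonglongrightarrow> (\<Prod>b\<in>J. indicator (A b) (x b))"
          by (intro tendsto_prod closed_approx_tendsto A)
        ultimately show "(\<lambda>t. ?k t x) \<longlonglongrightarrow> indicator S x"
          by simp
      qed
      moreover have "mean (?k t) = 0" for t
        by (rule cont) (auto intro: continuous_closed_approx simp: closed_approx_bounds)
      ultimately show ?thesis
        by (simp add: LIMSEQ_const_iff)
    qed
  qed (use h in \<open>auto simp: space_PiM\<close>)
qed

section \<open>Forms of matrices with entries in the unit interval\<close>

text \<open>A compact set that contains all overlaps; the forms and their products are bounded on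
  it, though not on the whole matrix space.\<close>

definition unit_matrices :: "(real ^ 'k::finite ^ 'k) set" where
  "unit_matrices = {A. \<forall>k k'. A $ k $ k' \<in> {0..1}}"

lemma hadamard_form_eq:
  "hadamard_form p A v = (\<Sum>k\<in>UNIV. \<Sum>k'\<in>UNIV. (A $ k $ k') ^ p * v $ k' * v $ k)"
  by (simp add: hadamard_form_def hadamard_power_def inner_vec_def matrix_vector_mult_def
      sum_distrib_right)

lemma continuous_hadamard_form [continuous_intros]:
  assumes "continuous_on S F"
  shows "continuous_on S (\<lambda>x. hadamard_form p (F x) v)"
  unfolding hadamard_form_eq by (intro continuous_intros assms)

lemma measurable_hadamard_form [measurable]: "(\<lambda>A. hadamard_form p A v) \<in> borel_measurable borel"
  by (intro borel_measurable_continuous_onI continuous_intros)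

text \<open>Each of the \<kappa> * \<kappa> summands has absolute value at most 1. The bound does
  not depend on \<open>v\<close>, which later permits dominated convergence along approximations of
  \<open>v\<close>.\<close>

lemma hadamard_form_bound:
  fixes A :: "real ^ 'k::finite ^ 'k"
  assumes A: "A \<in> unit_matrices" and v: "\<And>k. v $ k \<in> {-1..1}"
  shows "\<bar>hadamard_form p A v\<bar> \<le> real (CARD('k) * CARD('k))"
proof -
  have "\<bar>(A $ k $ k') ^ p * v $ k' * v $ k\<bar> \<le> 1" for k k'
  proof -
    have "\<bar>A $ k $ k'\<bar> \<le> 1" "\<bar>v $ k'\<bar> \<le> 1" "\<bar>v $ k\<bar> \<le> 1"
      using A v[of k] v[of k'] by (auto simp: unit_matrices_def abs_le_iff)
    then show ?thesis
      by (simp add: abs_mult power_abs mult_le_one power_le_one)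
  qed
  then have "\<bar>hadamard_form p A v\<bar> \<le> (\<Sum>k\<in>(UNIV :: 'k set). \<Sum>k'\<in>(UNIV :: 'k set). 1)"
    unfolding hadamard_form_eq by (intro order.trans[OF sum_abs] sum_mono)
  then show ?thesis
    by simp
qed

lemma measurable_pert_covariance [measurable]: "pert_covariance \<theta> \<in> borel_measurable borel"
proof -
  have "(\<lambda>A. \<Prod>(n, v)\<leftarrow>ws. hadamard_form p A v ^ n) \<in> borel_measurable borel" for p ws
    by (induction ws) auto
  then show ?thesis
    by (cases \<theta>) (simp add: pert_covariance_def)
qed

lemma continuous_pert_covariance [continuous_intros]:
  assumes "continuous_on S F"
  shows "continuous_on S (\<lambda>x. pert_covariance \<theta> (F x))"
proof -
  have "continuous_on S (\<lambda>x. \<Prod>(n, v)\<leftarrow>ws. hadamard_form p (F x) v ^ n)" for p ws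
    by (induction ws) (auto intro!: continuous_intros assms)
  then show ?thesis
    by (cases \<theta>) (simp add: pert_covariance_def)
qed

section \<open>Polynomials in several variables and their density\<close>

inductive power_sum :: "(real ^ 'm::finite \<Rightarrow> real) \<Rightarrow> bool" where
  monomial: "power_sum (\<lambda>x. c * (\<Prod>j\<in>UNIV. (x $ j) ^ \<alpha> j))"
| add: "power_sum q \<Longrightarrow> power_sum q' \<Longrightarrow> power_sum (\<lambda>x. q x + q' x)"

text \<open>Polynomials are presented as sums of monomials because monomials in the forms are what
  \<open>pert_covariance\<close> provides. Closure under products, demanded by Stone--Weierstrass,
  then takes two inductions: this one on one factor, with a monomial as the other, and the next one
  on the remaining factor.\<close>

lemma power_sum_mult_monomial:
  assumes "power_sum q"
  shows "power_sum (\<lambda>x. (c * (\<Prod>j\<in>UNIV. (x $ j) ^ \<alpha> j)) * q x)"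
  using assms
proof induction
  case (monomial c' \<alpha>')
  show ?case
    using power_sum.monomial[of "c * c'" "\<lambda>j. \<alpha> j + \<alpha>' j"]
    by (simp add: power_add prod.distrib mult_ac)
next
  case (add q q')
  then show ?case
    by (simp only: distrib_left power_sum.add)
qed

lemma power_sum_mult:
  assumes "power_sum q" "power_sum q'"
  shows "power_sum (\<lambda>x. q x * q' x)"
  using assms by induction (simp_all only: power_sum_mult_monomial distrib_right power_sum.add)

lemma power_sum_const: "power_sum (\<lambda>_. c)"
  using power_sum.monomial[of c "\<lambda>_. 0"] by simp

lemma power_sum_component: "power_sum (\<lambda>x. x $ j)"
proof -
  have "(\<Prod>i\<in>UNIV. (x $ i) ^ (if i = j then 1 else 0)) = x $ j" for x :: "real ^ 'a"
    by (subst prod.remove[of _ j]) (auto intro!: prod.neutral)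
  then show ?thesis
    using power_sum.monomial[of 1 "\<lambda>i. if i = j then 1 else 0"] by simp
qed

lemma continuous_power_sum: "power_sum q \<Longrightarrow> continuous_on S q"
  by (induction rule: power_sum.induct) (auto intro!: continuous_intros)

text \<open>The polynomials form an algebra of continuous functions containing the constants, and
  the coordinates separate points, so Stone--Weierstrass applies.\<close>

lemma uniform_approx_power_sum:
  assumes "compact S" "continuous_on S h" "0 < e"
  obtains q where "power_sum q" "\<And>x. x \<in> S \<Longrightarrow> \<bar>h x - q x\<bar> < e"
proof -
  have "\<exists>q. power_sum q \<and> (\<forall>x\<in>S. \<bar>h x - q x\<bar> < e)"
  proof (rule Stone_Weierstrass_HOL[OF assms(1) _ _ _ _ _ assms(2,3)])
    show "\<exists>q. power_sum q \<and> q x \<noteq> q y" if "x \<in> S \<and> y \<in> S \<and> x \<noteq> y" for x y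
      using that power_sum_component by (metis vec_eq_iff)
  qed (auto intro: power_sum_const continuous_power_sum power_sum.add power_sum_mult)
  then show ?thesis
    using that by blast
qed

section \<open>Rational parameters and monomials in the forms\<close>

lemma rational_cube_approx:
  fixes v :: "real ^ 'k::finite"
  assumes "\<And>k. v $ k \<in> {-1..1}"
  obtains w where "\<And>t. w t \<in> rational_cube" "w \<longlonglongrightarrow> v"
proof -
  \<comment> \<open>Every coordinate is rounded down to a multiple of \<open>1 / Suc t\<close>. As
    -1 is such a multiple, the result stays in \<open>{-1..1}\<close>, and the error is at most
    \<open>1 / Suc t\<close>.\<close>
  define w :: "nat \<Rightarrow> real ^ 'k"
    where "w t = (\<chi> k. of_int \<lfloor>v $ k * real (Suc t)\<rfloor> / real (Suc t))" for t
  show ?thesis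
  proof (rule that)
    fix t
    have "of_int \<lfloor>v $ k * real (Suc t)\<rfloor> / real (Suc t) \<in> {- 1..1 :: real}" for k
    proof -
      have "v $ k * real (Suc t) \<le> real (Suc t)"
        using assms[of k] mult_right_mono[of "v $ k" 1 "real (Suc t)"] by simp
      moreover have "- real (Suc t) \<le> v $ k * real (Suc t)"
        using assms[of k] mult_right_mono[of "-1" "v $ k" "real (Suc t)"] by simp
      then have "- int (Suc t) \<le> \<lfloor>v $ k * real (Suc t)\<rfloor>"
        by (subst le_floor_iff) simp
      then have "- real (Suc t) \<le> of_int \<lfloor>v $ k * real (Suc t)\<rfloor>"
        by linarith
      moreover have "of_int \<lfloor>v $ k * real (Suc t)\<rfloor> \<le> v $ k * real (Suc t)"
        by simp
      ultimately have "- real (Suc t) \<le> of_int \<lfloor>v $ k * real (Suc t)\<rfloor>"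
        "of_int \<lfloor>v $ k * real (Suc t)\<rfloor> \<le> real (Suc t)"
        by linarith+
      then show ?thesis
        by (simp add: field_simps del: of_nat_Suc)
    qed
    then show "w t \<in> rational_cube"
      by (auto simp: rational_cube_def w_def Rats_divide)
  next
    have "(\<lambda>t. w t $ k) \<longlonglongrightarrow> v $ k" for k
    proof (rule tendsto_sandwich[of "\<lambda>t. v $ k - 1 / real (Suc t)" _ _ "\<lambda>_. v $ k"])
      have "v $ k - 1 / real (Suc t) \<le> w t $ k \<and> w t $ k \<le> v $ k" for t
      proof -
        have "v $ k * real (Suc t) - 1 \<le> of_int \<lfloor>v $ k * real (Suc t)\<rfloor>"
          "of_int \<lfloor>v $ k * real (Suc t)\<rfloor> \<le> v $ k * real (Suc t)"
          by linarith+
        then show ?thesis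
          by (simp add: w_def pos_le_divide_eq pos_divide_le_eq left_diff_distrib del: of_nat_Suc)
      qed
      then show "\<forall>\<^sub>F t in sequentially. v $ k - 1 / real (Suc t) \<le> w t $ k"
        "\<forall>\<^sub>F t in sequentially. w t $ k \<le> v $ k"
        by simp_all
      show "(\<lambda>t. v $ k - 1 / real (Suc t)) \<longlonglongrightarrow> v $ k"
        using tendsto_diff[OF tendsto_const LIMSEQ_Suc[OF lim_1_over_n]] by simp
    qed simp
    then show "w \<longlonglongrightarrow> v"
      by (simp add: vec_tendstoI)
  qed
qed

lemma tendsto_hadamard_form:
  assumes "(w \<longlongrightarrow> v) F"
  shows "((\<lambda>t. hadamard_form p A (w t)) \<longlongrightarrow> hadamard_form p A v) F"
  unfolding hadamard_form_eq by (intro tendsto_intros assms)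

text \<open>A monomial in the forms is the covariance of the index listing the pairs of exponent and
  vector. Since \<open>pert_indices\<close> demands positive exponents, only the \<open>j\<close>
  with \<open>\<alpha> j \<noteq> 0\<close> are listed.\<close>

lemma weighted_mean_rational_monomial_eq_0:
  fixes v :: "'m::finite \<Rightarrow> real ^ 'k::finite"
  assumes one: "weighted_mean M I Z X (\<lambda>_. 1) = 0"
    and pert: "\<And>\<theta>. \<theta> \<in> pert_indices \<Longrightarrow> weighted_mean M I Z X (pert_covariance \<theta>) = 0"
    and p: "p \<ge> 1" and v: "\<And>j. v j \<in> rational_cube"
  shows "weighted_mean M I Z X (\<lambda>A. \<Prod>j\<in>UNIV. hadamard_form p A (v j) ^ \<alpha> j) = 0"
proof -
  obtain js where js: "set js = {j. \<alpha> j \<noteq> 0}" "distinct js"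
    using finite_distinct_list[of "{j. \<alpha> j \<noteq> 0}"] by auto
  define ws where "ws = map (\<lambda>j. (\<alpha> j, v j)) js"
  have eq: "(\<Prod>j\<in>UNIV. hadamard_form p A (v j) ^ \<alpha> j) = pert_covariance (p, ws) A" for A
  proof -
    have "pert_covariance (p, ws) A = (\<Prod>j\<leftarrow>js. hadamard_form p A (v j) ^ \<alpha> j)"
      by (simp add: pert_covariance_def ws_def o_def)
    also have "\<dots> = (\<Prod>j\<in>{j. \<alpha> j \<noteq> 0}. hadamard_form p A (v j) ^ \<alpha> j)"
      using prod.distinct_set_conv_list[OF js(2)] js(1) by metis
    also have "\<dots> = (\<Prod>j\<in>UNIV. hadamard_form p A (v j) ^ \<alpha> j)"
      by (rule prod.mono_neutral_left) auto
    finally show ?thesis ..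
  qed
  show ?thesis
  proof (cases "js = []")
    \<comment> \<open>All exponents vanish, and the monomial is the constant 1. The list of an index
      in \<open>pert_indices\<close> must be nonempty, so this case rests on
      \<open>one\<close>.\<close>
    case True
    then show ?thesis
      using one by (simp add: eq ws_def pert_covariance_def)
  next
    case False
    have "(p, ws) \<in> pert_indices"
      using False p v js(1) by (auto simp: pert_indices_def ws_def)
    then show ?thesis
      unfolding eq using pert by simp
  qed
qed

section \<open>Functions of finitely many forms of one matrix\<close>

context
  fixes M :: "'a measure" and I :: "'i set" and Z :: "'i \<Rightarrow> 'a \<Rightarrow> real"
    and X :: "'i \<Rightarrow> 'a \<Rightarrow> real ^ 'k::finite ^ 'k" and p :: nat
    and lam :: "'m::finite \<Rightarrow> real ^ 'k"
  assumes wv: "weighted_variables M (restrict_space borel unit_matrices) I Z X"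
    and one: "weighted_mean M I Z X (\<lambda>_. 1) = 0"
    and pert: "\<And>\<theta>. \<theta> \<in> pert_indices \<Longrightarrow> weighted_mean M I Z X (pert_covariance \<theta>) = 0"
    and p: "p \<ge> 1"
    and lam: "\<And>j k. lam j $ k \<in> {-1..1}"
begin

interpretation weighted_variables M "restrict_space borel unit_matrices" I Z X
  by (rule wv)

text \<open>The indices allow only rational vectors. Real ones are reached by dominated convergence,
  the forms being continuous in the vector and uniformly bounded on
  \<open>unit_matrices\<close>.\<close>

lemma weighted_mean_monomial_eq_0:
  "mean (\<lambda>A. \<Prod>j\<in>UNIV. hadamard_form p A (lam j) ^ \<alpha> j) = 0"
proof -
  have "\<exists>w. (\<forall>t. w t \<in> rational_cube) \<and> w \<longlonglongrightarrow> lam j" for j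
    by (rule rational_cube_approx[OF lam[of j]]) blast
  then obtain w where w: "\<And>j t. w j t \<in> rational_cube" "\<And>j. w j \<longlonglongrightarrow> lam j"
    by metis
  let ?h = "\<lambda>t A. \<Prod>j\<in>UNIV. hadamard_form p A (w j t) ^ \<alpha> j"
  have "(\<lambda>t. mean (?h t)) \<longlonglongrightarrow> mean (\<lambda>A. \<Prod>j\<in>UNIV. hadamard_form p A (lam j) ^ \<alpha> j)"
  proof (rule weighted_mean_tendsto)
    show "?h t \<in> borel_measurable (restrict_space borel unit_matrices)" for t
      by (rule measurable_restrict_space1) measurable
    show "\<bar>?h t A\<bar> \<le> (\<Prod>j\<in>UNIV. real (CARD('k) * CARD('k)) ^ \<alpha> j)"
      if "A \<in> space (restrict_space borel unit_matrices)" for t A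
    proof -
      have "A \<in> unit_matrices" "\<And>j k. w j t $ k \<in> {-1..1}"
        using that w(1) by (auto simp: space_restrict_space rational_cube_def)
      then have "\<bar>hadamard_form p A (w j t)\<bar> \<le> real (CARD('k) * CARD('k))" for j
        by (rule hadamard_form_bound)
      then show ?thesis
        unfolding abs_prod power_abs by (intro prod_mono conjI power_mono) auto
    qed
    show "(\<lambda>t. ?h t A) \<longlonglongrightarrow> (\<Prod>j\<in>UNIV. hadamard_form p A (lam j) ^ \<alpha> j)" for A
      by (intro tendsto_intros tendsto_hadamard_form w)
  qed
  moreover have "mean (?h t) = 0" for t
    by (rule weighted_mean_rational_monomial_eq_0[OF one pert p w(1)])
  ultimately show ?thesis
    by (simp add: LIMSEQ_const_iff)
qed

definition form_vector :: "real ^ 'k ^ 'k \<Rightarrow> real ^ 'm" where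
  "form_vector A = (\<chi> j. hadamard_form p A (lam j))"

lemma continuous_form_vector: "continuous_on S form_vector"
  unfolding form_vector_def by (intro continuous_intros)

lemma measurable_form_vector [measurable]:
  "form_vector \<in> borel_measurable (restrict_space borel unit_matrices)"
  by (intro measurable_restrict_space1 borel_measurable_continuous_onI continuous_form_vector)

lemma form_vector_cbox:
  assumes "A \<in> unit_matrices"
  shows "form_vector A \<in> cbox (\<chi> j. - real (CARD('k) * CARD('k))) (\<chi> j. real (CARD('k) * CARD('k)))"
proof -
  have "- real (CARD('k) * CARD('k)) \<le> hadamard_form p A (lam j) \<and>
      hadamard_form p A (lam j) \<le> real (CARD('k) * CARD('k))" for j
    using hadamard_form_bound[OF assms lam, of p j] by linarith
  then show ?thesis
    unfolding mem_box_cart form_vector_def vec_lambda_beta by blast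
qed

lemma weighted_mean_power_sum_eq_0:
  assumes "power_sum q"
  shows "mean (\<lambda>A. q (form_vector A)) = 0"
  using assms
proof induction
  case (monomial c \<alpha>)
  show ?case
    using weighted_mean_monomial_eq_0[of \<alpha>] by (simp add: weighted_mean_mult form_vector_def)
next
  case (add q q')
  \<comment> \<open>Additivity of the mean requires bounded summands; a polynomial is bounded on the
    compact cube in which the form vectors lie.\<close>
  have bound: "\<exists>B. \<forall>A\<in>unit_matrices. \<bar>r (form_vector A)\<bar> \<le> B" if "power_sum r" for r
  proof -
    let ?S = "cbox (\<chi> j. - real (CARD('k) * CARD('k))) (\<chi> j. real (CARD('k) * CARD('k))) :: (real ^ 'm) set"
    have "bounded (r ` ?S)"
      by (intro compact_imp_bounded compact_continuous_image continuous_power_sum that compact_cbox)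
    then show ?thesis
      using form_vector_cbox unfolding bounded_iff real_norm_def by blast
  qed
  obtain B B' where B: "\<And>A. A \<in> unit_matrices \<Longrightarrow> \<bar>q (form_vector A)\<bar> \<le> B"
    "\<And>A. A \<in> unit_matrices \<Longrightarrow> \<bar>q' (form_vector A)\<bar> \<le> B'"
    using bound add.hyps by metis
  have [measurable]: "q \<in> borel_measurable borel" "q' \<in> borel_measurable borel"
    using add.hyps by (auto intro!: borel_measurable_continuous_onI continuous_power_sum)
  have "mean (\<lambda>A. q (form_vector A) + q' (form_vector A)) =
      mean (\<lambda>A. q (form_vector A)) + mean (\<lambda>A. q' (form_vector A))"
    by (rule weighted_mean_add[where B = B and B' = B']) (auto simp: space_restrict_space B)
  then show ?case
    using add.IH by simp
qed

text \<open>On the cube containing all form vectors, \<open>h\<close> is a uniform limit of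
  polynomials, and these have mean 0.\<close>

lemma weighted_mean_continuous_form_eq_0:
  assumes h: "continuous_on UNIV h"
  shows "mean (\<lambda>A. h (form_vector A)) = 0"
proof -
  let ?S = "cbox (\<chi> j. - real (CARD('k) * CARD('k))) (\<chi> j. real (CARD('k) * CARD('k))) :: (real ^ 'm) set"
  have hS: "continuous_on ?S h"
    using h by (rule continuous_on_subset) simp
  have "\<exists>q. power_sum q \<and> (\<forall>x\<in>?S. \<bar>h x - q x\<bar> < 1 / real (Suc t))" for t
    by (rule uniform_approx_power_sum[OF compact_cbox hS, of "1 / real (Suc t)"]) auto
  then obtain q where q: "\<And>t. power_sum (q t)"
    and approx: "\<And>t x. x \<in> ?S \<Longrightarrow> \<bar>h x - q t x\<bar> < 1 / real (Suc t)"
    by metis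
  obtain B where B: "\<And>x. x \<in> ?S \<Longrightarrow> \<bar>h x\<bar> \<le> B"
    using compact_imp_bounded[OF compact_continuous_image[OF hS compact_cbox]]
    unfolding bounded_iff real_norm_def by blast
  have "(\<lambda>t. mean (\<lambda>A. q t (form_vector A))) \<longlonglongrightarrow> mean (\<lambda>A. h (form_vector A))"
  proof (rule weighted_mean_tendsto)
    show "(\<lambda>A. q t (form_vector A)) \<in> borel_measurable (restrict_space borel unit_matrices)" for t
      by (rule measurable_compose[OF measurable_form_vector])
        (intro borel_measurable_continuous_onI continuous_power_sum q)
    fix A :: "real ^ 'k ^ 'k" assume "A \<in> space (restrict_space borel unit_matrices)"
    then have A: "form_vector A \<in> ?S"
      using form_vector_cbox by (simp add: space_restrict_space)
    show "\<bar>q t (form_vector A)\<bar> \<le> B + 1" for t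
    proof -
      have "1 / real (Suc t) \<le> 1"
        by simp
      then show ?thesis
        using approx[OF A, of t] B[OF A] by linarith
    qed
    have "(\<lambda>t. h (form_vector A) - q t (form_vector A)) \<longlonglongrightarrow> 0"
      by (rule Lim_null_comparison[OF _ LIMSEQ_Suc[OF lim_1_over_n]])
        (use approx[OF A] in \<open>auto intro!: always_eventually less_imp_le\<close>)
    then show "(\<lambda>t. q t (form_vector A)) \<longlonglongrightarrow> h (form_vector A)"
      using tendsto_diff[OF tendsto_const[of "h (form_vector A)"]] by fastforce
  qed
  then show ?thesis
    using weighted_mean_power_sum_eq_0[OF q] by (simp add: LIMSEQ_const_iff)
qed

lemma weighted_mean_form_vector_eq_0:
  assumes "\<phi> \<in> borel_measurable borel" "bounded (range \<phi>)"
  shows "mean (\<lambda>A. \<phi> (\<chi> j. hadamard_form p A (lam j))) = 0"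
proof -
  \<comment> \<open>Composing the points with \<open>form_vector\<close> turns the mean over
    matrices into one over vectors in \<open>real ^ 'm\<close>, where the criterion for Borel
    functions on a metric space applies.\<close>
  have eq: "weighted_mean M I Z (\<lambda>i y. form_vector (X i y)) h = mean (\<lambda>A. h (form_vector A))" for h
    by (simp add: weighted_mean_def)
  have "weighted_mean M I Z (\<lambda>i y. form_vector (X i y)) \<phi> = 0"
  proof (rule weighted_mean_borel_eq_0[OF _ _ assms])
    show "weighted_variables M borel I Z (\<lambda>i y. form_vector (X i y))"
      by unfold_locales
        (use finite_I integrable_Z measurable_compose[OF measurable_X measurable_form_vector] in auto)
  qed (simp add: eq weighted_mean_continuous_form_eq_0)
  then show ?thesis
    unfolding eq unfolding form_vector_def .
qed

end

section \<open>The identities for the limiting array\<close>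

text \<open>A continuous retraction onto \<open>unit_matrices\<close>. Composed with it,
  \<open>pert_covariance\<close> becomes bounded and continuous on the whole matrix space, hence an
  admissible test function for \<open>overlap_limit\<close>.\<close>

definition clip_matrix :: "real ^ 'k::finite ^ 'k \<Rightarrow> real ^ 'k ^ 'k" where
  "clip_matrix A = (\<chi> k k'. max 0 (min 1 (A $ k $ k')))"

lemma clip_matrix_unit: "clip_matrix A \<in> unit_matrices"
  by (simp add: clip_matrix_def unit_matrices_def)

lemma clip_matrix_id: "A \<in> unit_matrices \<Longrightarrow> clip_matrix A = A"
  by (simp add: clip_matrix_def unit_matrices_def vec_eq_iff)

lemma continuous_clip_matrix [continuous_intros]:
  assumes "continuous_on S F"
  shows "continuous_on S (\<lambda>x. clip_matrix (F x))"
  unfolding clip_matrix_def by (intro continuous_intros assms)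

lemma measurable_clip_matrix [measurable]: "clip_matrix \<in> borel_measurable borel"
  by (intro borel_measurable_continuous_onI continuous_intros)

text \<open>The image of a continuous retraction is its set of fixed points, which is
  closed.\<close>

lemma closed_unit_matrices: "closed (unit_matrices :: (real ^ 'k::finite ^ 'k) set)"
proof -
  have "(unit_matrices :: (real ^ 'k ^ 'k) set) = {A. clip_matrix A = A}"
  proof (intro set_eqI iffI CollectI)
    fix A :: "real ^ 'k ^ 'k"
    show "clip_matrix A = A" if "A \<in> unit_matrices"
      by (rule clip_matrix_id) fact
    show "A \<in> unit_matrices" if "A \<in> {A. clip_matrix A = A}"
      using that clip_matrix_unit[of A] by simp
  qed
  moreover have "closed {A :: real ^ 'k ^ 'k. clip_matrix A = A}"
    by (intro closed_Collect_eq continuous_intros)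
  ultimately show ?thesis
    by simp
qed

lemma bounded_unit_matrices: "bounded (unit_matrices :: (real ^ 'k::finite ^ 'k) set)"
proof -
  have "norm A \<le> (\<Sum>k\<in>(UNIV :: 'k set). \<Sum>k'\<in>(UNIV :: 'k set). 1)"
    if "A \<in> unit_matrices" for A :: "real ^ 'k ^ 'k"
  proof -
    have "norm A \<le> (\<Sum>k\<in>UNIV. norm (A $ k))"
      unfolding norm_vec_def by (rule L2_set_le_sum) simp
    also have "\<dots> \<le> (\<Sum>k\<in>UNIV. \<Sum>k'\<in>UNIV. \<bar>A $ k $ k'\<bar>)"
      by (rule sum_mono) (rule norm_le_l1_cart)
    also have "\<dots> \<le> (\<Sum>k\<in>(UNIV :: 'k set). \<Sum>k'\<in>(UNIV :: 'k set). 1)"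
      using that by (intro sum_mono) (auto simp: unit_matrices_def)
    finally show ?thesis .
  qed
  then show ?thesis
    unfolding bounded_iff by blast
qed

lemma unit_matrices_nonempty: "unit_matrices \<noteq> {}"
  using clip_matrix_unit by blast

section \<open>Overlap matrices and their limits\<close>

lemma overlap_unit: "overlap N \<sigma> \<tau> \<in> unit_matrices"
proof -
  have "overlap N \<sigma> \<tau> $ k $ k' \<in> {0..1}" for k k'
  proof -
    define S :: real where "S = (\<Sum>i\<in>{1..N}. of_bool (\<sigma> i = k) * of_bool (\<tau> i = k'))"
    have "0 \<le> S"
      unfolding S_def by (rule sum_nonneg) simp
    moreover have "S \<le> real (card {1..N}) * 1"
      unfolding S_def by (rule sum_bounded_above) simp
    \<comment> \<open>For \<open>N = 0\<close> the quotient is 0 by the convention on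
      division.\<close>
    ultimately have "S / real N \<in> {0..1}"
      by (cases "N = 0") auto
    moreover have "overlap N \<sigma> \<tau> $ k $ k' = S / real N"
      by (simp only: overlap_def S_def vec_lambda_beta mult_1 times_divide_eq_left)
    ultimately show ?thesis
      by simp
  qed
  then show ?thesis
    by (simp add: unit_matrices_def)
qed

lemma clip_matrix_overlap_array: "clip_matrix (overlap_array N s b) = overlap_array N s b"
  by (cases b) (simp add: overlap_array_def clip_matrix_id overlap_unit)

lemma pert_covariance_clip_bounded: "bounded (range (\<lambda>A. pert_covariance \<theta> (clip_matrix A)))"
proof -
  have "compact (unit_matrices :: (real ^ 'a ^ 'a) set)"
    by (simp add: compact_eq_bounded_closed closed_unit_matrices bounded_unit_matrices)
  then have "bounded (pert_covariance \<theta> ` unit_matrices)"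
    by (intro compact_imp_bounded compact_continuous_image continuous_intros)
  then show ?thesis
    by (rule bounded_subset) (auto simp: clip_matrix_unit)
qed

text \<open>The factor \<open>c\<close> stands for a covariance at an entry \<open>b\<close> that
  may lie outside \<open>J\<close>, as \<open>(1, n + 1)\<close> lies outside
  \<open>block n\<close>; convergence is therefore tested on the subfamily indexed by
  \<open>insert b J\<close>.\<close>

lemma overlap_limit_product:
  fixes k :: "nat \<times> nat \<Rightarrow> real ^ 'k::finite ^ 'k \<Rightarrow> real"
  assumes lim: "overlap_limit E r M' R"
    and J: "finite J" "J \<subseteq> {1..} \<times> {1..}" and b: "b \<in> {1..} \<times> {1..}"
    and k: "\<And>b. continuous_on UNIV (k b)" "\<And>b A. k b A \<in> {0..1}"
    and c: "continuous_on UNIV c" "bounded (range c)"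
  shows "(\<lambda>t. E (r t) (\<lambda>s. (\<Prod>i\<in>J. k i (overlap_array (r t) s i)) * c (overlap_array (r t) s b)))
    \<longlonglongrightarrow> (LINT y|M'. (\<Prod>i\<in>J. k i (R y i)) * c (R y b))"
proof -
  let ?F = "\<lambda>x. (\<Prod>i\<in>J. k i (x i)) * c (x b)"
  let ?J = "insert b J"
  have comp: "continuous_map (product_topology (\<lambda>_. euclidean) ?J) euclideanreal (\<lambda>x. q (x i))"
    if "continuous_on UNIV q" "i \<in> ?J" for q :: "real ^ 'k ^ 'k \<Rightarrow> real" and i
    using continuous_map_compose[OF continuous_map_product_projection[OF that(2)], of "\<lambda>_. euclidean" euclideanreal q]
      that(1) by (simp add: o_def)
  have "continuous_map (product_topology (\<lambda>_. euclidean) ?J) euclideanreal ?F"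
    by (intro continuous_map_real_mult continuous_map_prod comp k c J) auto
  moreover obtain B where B: "\<And>A. \<bar>c A\<bar> \<le> B"
    using c(2) by (auto simp: bounded_iff)
  have "\<bar>?F x\<bar> \<le> B" for x
  proof -
    have "\<bar>\<Prod>i\<in>J. k i (x i)\<bar> \<le> 1"
      using k(2) by (auto simp: abs_prod intro!: prod_le_1)
    then show ?thesis
      using mult_mono[of "\<bar>\<Prod>i\<in>J. k i (x i)\<bar>" 1 "\<bar>c (x b)\<bar>" B] B[of "x b"] by (simp add: abs_mult)
  qed
  then have "bounded (?F ` (?J \<rightarrow>\<^sub>E UNIV))"
    by (auto simp: bounded_iff)
  ultimately have "(\<lambda>t. E (r t) (\<lambda>s. ?F (restrict (overlap_array (r t) s) ?J)))
      \<longlonglongrightarrow> (LINT y|M'. ?F (restrict (R y) ?J))"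
    using lim J b unfolding overlap_limit_def by blast
  moreover have "?F (restrict z ?J) = ?F z" for z
    by simp
  ultimately show ?thesis
    by (simp only:)
qed

text \<open>The distance to \<open>unit_matrices\<close>, truncated at 1, is a bounded continuous
  test function vanishing on all overlaps. Its expectation in the limit is thus 0, so it vanishes
  almost surely, and closedness turns distance 0 into membership.\<close>

lemma overlap_limit_unit:
  fixes R :: "'v \<Rightarrow> nat \<times> nat \<Rightarrow> real ^ 'k::finite ^ 'k"
  assumes lim: "overlap_limit E r M' R" and E: "\<And>N. E N (\<lambda>_. 0) = 0"
    and M': "prob_space M'" and b: "b \<in> {1..} \<times> {1..}"
    and R: "(\<lambda>y. R y b) \<in> borel_measurable M'"
  shows "AE y in M'. R y b \<in> unit_matrices"
proof -
  interpret prob_space M' by fact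
  let ?c = "\<lambda>A :: real ^ 'k ^ 'k. min 1 (infdist A unit_matrices)"
  have cont: "continuous_on UNIV ?c"
    by (intro continuous_intros)
  have bd: "bounded (range ?c)"
    by (auto simp: bounded_iff infdist_nonneg intro!: exI[of _ 1])
  have "(\<lambda>t. E (r t) (\<lambda>s. ?c (overlap_array (r t) s b))) \<longlonglongrightarrow> (LINT y|M'. ?c (R y b))"
    using overlap_limit_product[OF lim, of "{}" b "\<lambda>_ _. 0" ?c] b cont bd by simp
  moreover have "?c (overlap_array N s b) = 0" for N s
    by (cases b) (simp add: overlap_array_def overlap_unit)
  ultimately have "(LINT y|M'. ?c (R y b)) = 0"
    by (simp add: E LIMSEQ_const_iff)
  have meas: "(\<lambda>y. ?c (R y b)) \<in> borel_measurable M'"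
    using measurable_compose[OF R borel_measurable_continuous_onI[OF cont]] .
  have int: "integrable M' (\<lambda>y. ?c (R y b))"
    by (rule integrable_const_bound[where B = 1]) (use meas in \<open>auto simp: infdist_nonneg\<close>)
  have "AE y in M'. ?c (R y b) = 0"
    using integral_nonneg_eq_0_iff_AE[OF int] \<open>(LINT y|M'. ?c (R y b)) = 0\<close>
    by (simp add: infdist_nonneg)
  then show ?thesis
    by eventually_elim
      (auto simp: min_def in_closed_iff_infdist_zero[OF closed_unit_matrices unit_matrices_nonempty]
        split: if_splits)
qed

section \<open>Passage to the limit in the Ghirlanda-Guerra identities\<close>

lemma finite_block: "finite (block n)"
  by (simp add: block_def)

lemma block_subset: "block n \<subseteq> {1..} \<times> {1..}"
  by (auto simp: block_def)

text \<open>For continuous factors every expectation in the approximate identity converges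
  separately along \<open>r\<close>; the absolute defect then tends both to 0 and to the defect of
  the limiting identity.\<close>

lemma Ghirlanda_Guerra_product:
  fixes R :: "'v \<Rightarrow> nat \<times> nat \<Rightarrow> real ^ 'k::finite ^ 'k"
  assumes GG: "approximate_Ghirlanda_Guerra E" and lim: "overlap_limit E r M' R"
    and r: "strict_mono r" and n: "n \<ge> 2" and \<theta>: "\<theta> \<in> pert_indices"
    and k: "\<And>b. continuous_on UNIV (k b)" "\<And>b A. k b A \<in> {0..1}"
  defines "K \<equiv> \<lambda>y. \<Prod>b\<in>block n. k b (R y b)"
    and "C \<equiv> \<lambda>l y. pert_covariance \<theta> (clip_matrix (R y (1, l)))"
  shows "(LINT y|M'. K y * C (n + 1) y) = 1 / real n * (LINT y|M'. K y) * (LINT y|M'. C 2 y)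
    + 1 / real n * (\<Sum>l\<in>{2..n}. LINT y|M'. K y * C l y)"
proof -
  let ?f = "\<lambda>x. \<Prod>b\<in>block n. k b (x b)"
  let ?c = "\<lambda>A. pert_covariance \<theta> (clip_matrix A)"
  let ?F = "\<lambda>N s. \<Prod>b\<in>block n. k b (overlap_array N s b)"
  let ?C = "\<lambda>N l s. ?c (overlap_array N s (1, l))"
  have [measurable]: "k b \<in> borel_measurable borel" for b
    by (intro borel_measurable_continuous_onI k)
  have "bounded_measurable_block n ?f"
    unfolding bounded_measurable_block_def
  proof
    show "?f \<in> borel_measurable (PiM (block n) (\<lambda>_. borel))"
      by measurable
    have "\<bar>?f x\<bar> \<le> 1" for x
      using k(2) by (auto simp: abs_prod intro!: prod_le_1)
    then show "bounded (?f ` (block n \<rightarrow>\<^sub>E UNIV))"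
      by (auto simp: bounded_iff)
  qed
  then have "(\<lambda>N. \<bar>E N (\<lambda>s. ?f (restrict (overlap_array N s) (block n)) * pert_covariance \<theta> (overlap_array N s (1, n + 1)))
                 - 1 / real n * E N (\<lambda>s. ?f (restrict (overlap_array N s) (block n))) * E N (\<lambda>s. pert_covariance \<theta> (overlap_array N s (1, 2)))
                 - 1 / real n * (\<Sum>l\<in>{2..n}. E N (\<lambda>s. ?f (restrict (overlap_array N s) (block n)) * pert_covariance \<theta> (overlap_array N s (1, l))))\<bar>)
            \<longlonglongrightarrow> 0"
    using GG n \<theta> unfolding approximate_Ghirlanda_Guerra_def Let_def by blast
  moreover have "?f (restrict z (block n)) = ?f z" for z
    by simp
  \<comment> \<open>Overlaps are fixed by clipping, so the bounded covariance \<open>?C\<close> may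
    replace the original one at each finite \<open>N\<close>.\<close>
  ultimately have "(\<lambda>N. \<bar>E N (\<lambda>s. ?F N s * ?C N (n + 1) s) - 1 / real n * E N (?F N) * E N (?C N 2)
      - 1 / real n * (\<Sum>l\<in>{2..n}. E N (\<lambda>s. ?F N s * ?C N l s))\<bar>) \<longlonglongrightarrow> 0"
    by (simp only: clip_matrix_overlap_array)
  from LIMSEQ_subseq_LIMSEQ[OF this r]
  have "(\<lambda>t. \<bar>E (r t) (\<lambda>s. ?F (r t) s * ?C (r t) (n + 1) s) - 1 / real n * E (r t) (?F (r t)) * E (r t) (?C (r t) 2)
      - 1 / real n * (\<Sum>l\<in>{2..n}. E (r t) (\<lambda>s. ?F (r t) s * ?C (r t) l s))\<bar>) \<longlonglongrightarrow> 0"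
    by (simp only: o_def)
  moreover have "(\<lambda>t. \<bar>E (r t) (\<lambda>s. ?F (r t) s * ?C (r t) (n + 1) s) - 1 / real n * E (r t) (?F (r t)) * E (r t) (?C (r t) 2)
      - 1 / real n * (\<Sum>l\<in>{2..n}. E (r t) (\<lambda>s. ?F (r t) s * ?C (r t) l s))\<bar>)
    \<longlonglongrightarrow> \<bar>(LINT y|M'. K y * C (n + 1) y) - 1 / real n * (LINT y|M'. K y) * (LINT y|M'. C 2 y)
      - 1 / real n * (\<Sum>l\<in>{2..n}. LINT y|M'. K y * C l y)\<bar>"
  proof -
    have c: "continuous_on UNIV ?c"
      by (intro continuous_intros)
    have FC: "(\<lambda>t. E (r t) (\<lambda>s. ?F (r t) s * ?C (r t) l s)) \<longlonglongrightarrow> (LINT y|M'. K y * C l y)"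
      if "l \<ge> 1" for l
      unfolding K_def C_def
      by (rule overlap_limit_product[OF lim finite_block block_subset _ k c pert_covariance_clip_bounded])
        (use that in auto)
    \<comment> \<open>With the extra factor equal to 1 the entry \<open>(1, 1)\<close> is a dummy.
      The next fact uses instead the empty product, which leaves only the covariance.\<close>
    have F: "(\<lambda>t. E (r t) (?F (r t))) \<longlonglongrightarrow> (LINT y|M'. K y)"
      using overlap_limit_product[OF lim finite_block block_subset _ k, of "(1, 1)" "\<lambda>_. 1"]
      by (simp add: K_def)
    have C: "(\<lambda>t. E (r t) (?C (r t) 2)) \<longlonglongrightarrow> (LINT y|M'. C 2 y)"
      using overlap_limit_product[OF lim, of "{}" "(1, 2)" "\<lambda>_ _. 0", OF _ _ _ _ _ c pert_covariance_clip_bounded]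
      by (simp add: C_def)
    show ?thesis
      by (intro tendsto_rabs tendsto_diff tendsto_mult tendsto_const tendsto_sum FC F C) auto
  qed
  ultimately have "0 = \<bar>(LINT y|M'. K y * C (n + 1) y) - 1 / real n * (LINT y|M'. K y) * (LINT y|M'. C 2 y)
      - 1 / real n * (\<Sum>l\<in>{2..n}. LINT y|M'. K y * C l y)\<bar>"
    by (rule LIMSEQ_unique)
  then show ?thesis
    by linarith
qed

lemma Ghirlanda_Guerra_pert_covariance:
  fixes R :: "'v \<Rightarrow> nat \<times> nat \<Rightarrow> real ^ 'k::finite ^ 'k"
  assumes GG: "approximate_Ghirlanda_Guerra E" and lim: "overlap_limit E r M' R"
    and r: "strict_mono r" and n: "n \<ge> 2" and \<theta>: "\<theta> \<in> pert_indices"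
    and M': "prob_space M'"
    and R: "\<And>l l'. l \<ge> 1 \<Longrightarrow> l' \<ge> 1 \<Longrightarrow> (\<lambda>y. R y (l, l')) \<in> borel_measurable M'"
    and f: "bounded_measurable_block n f"
  defines "F \<equiv> \<lambda>y. f (restrict (\<lambda>b. clip_matrix (R y b)) (block n))"
    and "C \<equiv> \<lambda>l y. pert_covariance \<theta> (clip_matrix (R y (1, l)))"
  shows "(LINT y|M'. F y * C (n + 1) y) = 1 / real n * (LINT y|M'. F y) * (LINT y|M'. C 2 y)
    + 1 / real n * (\<Sum>l\<in>{2..n}. LINT y|M'. F y * C l y)"
proof -
  interpret prob_space M' by fact
  \<comment> \<open>The product of expectations is absorbed as a constant, the mean of
    \<open>C 2\<close>, inside the weight. The whole identity becomes linear in the test function of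
    the clipped block, with one index only.\<close>
  define Z where "Z (i :: unit) y = C (n + 1) y - 1 / real n * (LINT y|M'. C 2 y)
    - 1 / real n * (\<Sum>l\<in>{2..n}. C l y)" for i y
  define X where "X (i :: unit) y = restrict (\<lambda>b. clip_matrix (R y b)) (block n)" for i y
  have Rb: "(\<lambda>y. R y b) \<in> borel_measurable M'" if "b \<in> {1..} \<times> {1..}" for b
    using that R by (cases b) auto
  have C_meas: "C l \<in> borel_measurable M'" if "l \<ge> 1" for l
  proof -
    note [measurable] = R[OF order_refl that]
    show ?thesis
      unfolding C_def by measurable
  qed
  obtain B where B: "\<And>l y. \<bar>C l y\<bar> \<le> B"
    using pert_covariance_clip_bounded[of \<theta>] unfolding bounded_iff C_def by auto
  have X_meas: "X i \<in> measurable M' (PiM (block n) (\<lambda>_. borel))" for i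
    unfolding X_def
    by (intro measurable_restrict measurable_compose[OF Rb measurable_clip_matrix])
      (use block_subset in blast)
  have C_int: "integrable M' (C l)" if "l \<ge> 1" for l
    by (rule integrable_const_bound[where B = B]) (use B C_meas[OF that] in auto)
  interpret wv: weighted_variables M' "PiM (block n) (\<lambda>_. borel)" UNIV Z X
  proof
    show "integrable M' (Z i)" for i
      unfolding Z_def [abs_def]
      by (intro Bochner_Integration.integrable_diff integrable_mult_right
          Bochner_Integration.integrable_sum C_int) auto
  qed (use X_meas in auto)
  have expand: "wv.mean h = (LINT y|M'. h (X () y) * C (n + 1) y)
      - 1 / real n * (LINT y|M'. h (X () y)) * (LINT y|M'. C 2 y)
      - 1 / real n * (\<Sum>l\<in>{2..n}. LINT y|M'. h (X () y) * C l y)"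
    if h: "h \<in> borel_measurable (PiM (block n) (\<lambda>_. borel))" "bounded (h ` (block n \<rightarrow>\<^sub>E UNIV))" for h
  proof -
    obtain D where D: "\<And>x. x \<in> block n \<rightarrow>\<^sub>E UNIV \<Longrightarrow> \<bar>h x\<bar> \<le> D"
      using h(2) by (auto simp: bounded_iff)
    have hX: "\<bar>h (X () y)\<bar> \<le> D" for y
      by (rule D) (simp add: X_def)
    have hX_meas [measurable]: "(\<lambda>y. h (X () y)) \<in> borel_measurable M'"
      using measurable_compose[OF X_meas h(1)] .
    have hX_int: "integrable M' (\<lambda>y. h (X () y))"
      by (rule integrable_const_bound[where B = D]) (use hX in auto)
    have hC_int: "integrable M' (\<lambda>y. h (X () y) * C l y)" if "l \<ge> 1" for l
    proof (rule integrable_const_bound[where B = "D * B"])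
      show "(\<lambda>y. h (X () y) * C l y) \<in> borel_measurable M'"
        using C_meas[OF that] by measurable
      show "AE y in M'. norm (h (X () y) * C l y) \<le> D * B"
        using hX B by (intro AE_I2) (auto simp: abs_mult intro!: mult_mono' order.trans[OF abs_ge_zero hX])
    qed
    have int: "integrable M' (\<lambda>y. h (X () y) * C (n + 1) y)"
      "integrable M' (\<lambda>y. 1 / real n * (LINT y|M'. C 2 y) * h (X () y))"
      "integrable M' (\<lambda>y. 1 / real n * (\<Sum>l\<in>{2..n}. h (X () y) * C l y))"
      by (intro integrable_mult_right Bochner_Integration.integrable_sum hC_int hX_int; simp)+
    have int_sum: "(LINT y|M'. (\<Sum>l\<in>{2..n}. h (X () y) * C l y)) =
        (\<Sum>l\<in>{2..n}. LINT y|M'. h (X () y) * C l y)"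
      by (rule Bochner_Integration.integral_sum) (rule hC_int, simp)
    have "wv.mean h = (LINT y|M'. h (X () y) * C (n + 1) y
        - 1 / real n * (LINT y|M'. C 2 y) * h (X () y)
        - 1 / real n * (\<Sum>l\<in>{2..n}. h (X () y) * C l y))"
      by (simp add: weighted_mean_def Z_def UNIV_unit algebra_simps sum_distrib_left)
    also have "\<dots> = (LINT y|M'. h (X () y) * C (n + 1) y)
        - 1 / real n * (LINT y|M'. C 2 y) * (LINT y|M'. h (X () y))
        - 1 / real n * (\<Sum>l\<in>{2..n}. LINT y|M'. h (X () y) * C l y)"
      by (simp only: Bochner_Integration.integral_diff[OF Bochner_Integration.integrable_diff[OF int(1,2)] int(3)]
          Bochner_Integration.integral_diff[OF int(1,2)] integral_mult_right_zero int_sum)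
    finally show ?thesis
      by (simp add: mult_ac)
  qed
  have "wv.mean f = 0"
  proof (rule weighted_mean_PiM_borel_eq_0[OF wv.weighted_variables_axioms finite_block])
    fix k :: "nat \<times> nat \<Rightarrow> real ^ 'k ^ 'k \<Rightarrow> real"
    assume k: "\<And>b. continuous_on UNIV (k b)" "\<And>b A. k b A \<in> {0..1}"
    have [measurable]: "k b \<in> borel_measurable borel" for b
      by (intro borel_measurable_continuous_onI k)
    let ?h = "\<lambda>x. \<Prod>b\<in>block n. k b (x b)"
    have "\<bar>?h x\<bar> \<le> 1" for x
      using k(2) by (auto simp: abs_prod intro!: prod_le_1)
    then have bd: "bounded (?h ` (block n \<rightarrow>\<^sub>E UNIV))"
      by (auto simp: bounded_iff)
    \<comment> \<open>The points \<open>X\<close> are clipped whereas the product identity is stated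
      for \<open>R\<close>, so it is applied to the factors \<open>k b\<close> composed with
      \<open>clip_matrix\<close>.\<close>
    have cont: "continuous_on UNIV (\<lambda>A. k b (clip_matrix A))" for b
      by (rule continuous_on_compose2[OF k(1)]) (auto intro: continuous_intros)
    have X: "?h (X () y) = (\<Prod>b\<in>block n. k b (clip_matrix (R y b)))" for y
      by (simp add: X_def)
    have "?h \<in> borel_measurable (PiM (block n) (\<lambda>_. borel))"
      by measurable
    from expand[OF this bd]
    show "wv.mean ?h = 0"
      using Ghirlanda_Guerra_product[OF GG lim r n \<theta>, of "\<lambda>b A. k b (clip_matrix A)", OF cont] k(2)
      unfolding X C_def by simp
  qed (use f in \<open>auto simp: bounded_measurable_block_def\<close>)
  moreover have "F y = f (X () y)" for y
    by (simp add: F_def X_def)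
  ultimately show ?thesis
    using expand[of f] f by (simp add: bounded_measurable_block_def)
qed

theorem theorem2:
  fixes M :: "'w measure"
    and g :: "nat \<Rightarrow> 'k::finite coupling \<Rightarrow> 'w \<Rightarrow> real"
    and j0 :: "real ^ 'k \<Rightarrow> nat"
    and a :: real
    and d :: "nat \<Rightarrow> real ^ 'k"
    and u :: "nat \<Rightarrow> 'k pert_index \<Rightarrow> real"
    and r :: "nat \<Rightarrow> nat"
    and M' :: "'v measure"
    and R :: "'v \<Rightarrow> nat \<times> nat \<Rightarrow> real ^ 'k ^ 'k"
    and p n :: nat
    and lam :: "'m::finite \<Rightarrow> real ^ 'k"
    and \<phi> :: "real ^ 'm \<Rightarrow> real"
    and f :: "(nat \<times> nat \<Rightarrow> real ^ 'k ^ 'k) \<Rightarrow> real"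
    and Q :: "nat \<Rightarrow> nat \<Rightarrow> 'v \<Rightarrow> real"
  assumes M: "prob_space M"
    and g_indep: "\<And>N. N \<ge> 1 \<Longrightarrow> prob_space.indep_vars M (\<lambda>_. borel) (g N) (couplings N)"
    and g_normal: "\<And>N c. N \<ge> 1 \<Longrightarrow> c \<in> couplings N \<Longrightarrow>
          distributed M lborel (g N c) std_normal_density"
    and j0: "inj_on j0 rational_cube"
    and a: "1 / 4 < a" "a < 1 / 2"
    and d: "\<And>N. N \<ge> 1 \<Longrightarrow> d N \<in> admissible_proportions N"
    and u: "\<And>N \<theta>. N \<ge> 1 \<Longrightarrow> \<theta> \<in> pert_indices \<Longrightarrow> u N \<theta> \<in> {1..2}"
    and GG: "approximate_Ghirlanda_Guerra (replica_mean M g j0 a d u)"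
    and M': "prob_space M'"
    and R: "\<And>l l'. l \<ge> 1 \<Longrightarrow> l' \<ge> 1 \<Longrightarrow> (\<lambda>y. R y (l, l')) \<in> borel_measurable M'"
    and r: "strict_mono r"
    and lim: "overlap_limit (replica_mean M g j0 a d u) r M' R"
    and p: "p \<ge> 1"
    and lam: "\<And>j k. lam j $ k \<in> {-1..1}"
    and phi: "\<phi> \<in> borel_measurable borel" "bounded (range \<phi>)"
    and Q: "\<And>l l' y. Q l l' y = \<phi> (\<chi> j. hadamard_form p (R y (l, l')) (lam j))"
    and n: "n \<ge> 2"
    and f: "bounded_measurable_block n f"
  shows "(LINT y|M'. f (restrict (R y) (block n)) * Q 1 (n + 1) y) =
      1 / real n * (LINT y|M'. f (restrict (R y) (block n))) * (LINT y|M'. Q 1 2 y)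
      + 1 / real n * (\<Sum>l\<in>{2..n}. LINT y|M'. f (restrict (R y) (block n)) * Q 1 l y)"
proof -
  interpret prob_space M' by fact
  \<comment> \<open>The argument runs with clipped overlaps, which lie in
    \<open>unit_matrices\<close> everywhere; \<open>R\<close> returns at the end because it agrees
    with its clipped version almost surely.\<close>
  define F where "F y = f (restrict (\<lambda>b. clip_matrix (R y b)) (block n))" for y
  define Y where "Y l y = clip_matrix (R y (1, l))" for l y
  define H where "H A = \<phi> (\<chi> j. hadamard_form p A (lam j))" for A :: "real ^ 'k ^ 'k"
  \<comment> \<open>The entry \<open>(1, 1)\<close> does not occur in the identity, so the index 1
    is free to carry the product of expectations: its weight is a constant multiple of the mean of
    \<open>F\<close>, and its point is \<open>Y 2\<close>.\<close>
  define Z where "Z i y = (if i = n + 1 then F y else if i = 1 then - 1 / real n * (LINT y|M'. F y)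
    else - 1 / real n * F y)" for i y
  define X where "X i = Y (if i = 1 then 2 else i)" for i :: nat
  have Rb: "(\<lambda>y. R y b) \<in> borel_measurable M'" if "b \<in> {1..} \<times> {1..}" for b
    using that R by (cases b) auto
  have fm: "f \<in> borel_measurable (PiM (block n) (\<lambda>_. borel))"
    using f by (simp add: bounded_measurable_block_def)
  obtain B where B: "\<And>x. x \<in> block n \<rightarrow>\<^sub>E UNIV \<Longrightarrow> \<bar>f x\<bar> \<le> B"
    using f by (auto simp: bounded_measurable_block_def bounded_iff)
  have F_meas [measurable]: "F \<in> borel_measurable M'"
    unfolding F_def [abs_def]
    by (intro measurable_compose[OF _ fm] measurable_restrict
        measurable_compose[OF Rb measurable_clip_matrix]) (use block_subset in blast)
  have F_int: "integrable M' F"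
    by (rule integrable_const_bound[where B = B]) (auto simp: F_def intro!: B)
  have Y_meas: "Y l \<in> measurable M' (restrict_space borel unit_matrices)" if "l \<ge> 1" for l
    unfolding Y_def [abs_def] using that
    by (intro measurable_restrict_space2 measurable_compose[OF Rb measurable_clip_matrix])
      (auto simp: clip_matrix_unit)
  interpret wv: weighted_variables M' "restrict_space borel unit_matrices" "{1..n+1}" Z X
  proof
    show "integrable M' (Z i)" for i
      unfolding Z_def [abs_def] using F_int by (cases "i = n + 1"; cases "i = 1") auto
    show "X i \<in> measurable M' (restrict_space borel unit_matrices)" if "i \<in> {1..n+1}" for i
      unfolding X_def by (rule Y_meas) (use that in auto)
  qed simp
  have expand: "wv.mean h = (LINT y|M'. F y * h (Y (n + 1) y))
      - (1 / real n * (LINT y|M'. F y) * (LINT y|M'. h (Y 2 y))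
      + 1 / real n * (\<Sum>l\<in>{2..n}. LINT y|M'. F y * h (Y l y)))" for h
  proof -
    let ?t = "\<lambda>i. LINT y|M'. Z i y * h (X i y)"
    have "{1..n+1} = insert 1 (insert (n + 1) {2..n})"
      using n by auto
    then have "wv.mean h = ?t 1 + (?t (n + 1) + (\<Sum>l\<in>{2..n}. ?t l))"
      using n by (simp add: weighted_mean_def)
    moreover have "?t 1 = - (1 / real n * (LINT y|M'. F y) * (LINT y|M'. h (Y 2 y)))"
      using n by (simp add: Z_def X_def)
    moreover have "?t (n + 1) = (LINT y|M'. F y * h (Y (n + 1) y))"
      using n by (simp add: Z_def X_def)
    moreover have "(\<Sum>l\<in>{2..n}. ?t l) = - (1 / real n * (\<Sum>l\<in>{2..n}. LINT y|M'. F y * h (Y l y)))"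
      unfolding sum_distrib_left sum_negf[symmetric]
      by (rule sum.cong) (auto simp: Z_def X_def mult.assoc)
    ultimately show ?thesis
      by simp
  qed
  have "wv.mean H = 0"
    unfolding H_def [abs_def]
  proof (rule weighted_mean_form_vector_eq_0[OF wv.weighted_variables_axioms _ _ p lam phi])
    \<comment> \<open>For the constant 1 every term is a multiple of the mean of \<open>F\<close>,
      and the coefficients cancel: \<open>1 - 1 / n - (n - 1) / n = 0\<close>.\<close>
    show "wv.mean (\<lambda>_. 1) = 0"
      unfolding expand using n by (simp add: prob_space field_simps of_nat_diff)
    show "wv.mean (pert_covariance \<theta>) = 0" if "\<theta> \<in> pert_indices" for \<theta>
      unfolding expand F_def Y_def
      using Ghirlanda_Guerra_pert_covariance[OF GG lim r n that M' R f] by simp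
  qed
  then have identity: "(LINT y|M'. F y * H (Y (n + 1) y)) = 1 / real n * (LINT y|M'. F y) * (LINT y|M'. H (Y 2 y))
      + 1 / real n * (\<Sum>l\<in>{2..n}. LINT y|M'. F y * H (Y l y))"
    unfolding expand by simp
  have unit: "AE y in M'. R y b \<in> unit_matrices" if "b \<in> {1..} \<times> {1..}" for b
    by (rule overlap_limit_unit[OF lim _ M' that Rb[OF that]]) (simp add: replica_mean_def)
  have F_AE: "AE y in M'. f (restrict (R y) (block n)) = F y"
  proof -
    \<comment> \<open>The exceptional null sets can be united since the block is finite.\<close>
    have "AE y in M'. \<forall>b\<in>block n. R y b \<in> unit_matrices"
      using unit block_subset by (subst AE_finite_all[OF finite_block]) blast
    then show ?thesis
      by eventually_elim (auto simp: F_def clip_matrix_id intro!: arg_cong[where f = f])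
  qed
  have Q_AE: "AE y in M'. Q 1 l y = H (Y l y)" if "l \<ge> 1" for l
    using unit[of "(1, l)"] that by (auto simp: Q H_def Y_def clip_matrix_id elim: AE_mp)
  have [measurable]: "(\<lambda>y. f (restrict (R y) (block n))) \<in> borel_measurable M'"
    by (intro measurable_compose[OF _ fm] measurable_restrict Rb) (use block_subset in blast)
  have H_meas: "H \<in> borel_measurable borel"
    unfolding H_def [abs_def]
    by (intro measurable_compose[OF _ phi(1)] borel_measurable_continuous_onI continuous_intros)
  have Q_meas: "Q 1 l \<in> borel_measurable M'" if "l \<ge> 1" for l
    using measurable_compose[OF R[OF order_refl that] H_meas] by (simp add: Q [abs_def] H_def)
  have HY_meas: "(\<lambda>y. H (Y l y)) \<in> borel_measurable M'" if "l \<ge> 1" for l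
    unfolding Y_def
    by (rule measurable_compose[OF measurable_compose[OF R[OF order_refl that] measurable_clip_matrix] H_meas])
  have FQ: "(LINT y|M'. f (restrict (R y) (block n)) * Q 1 l y) = (LINT y|M'. F y * H (Y l y))"
    if "l \<ge> 1" for l
  proof (rule integral_cong_AE)
    note [measurable] = Q_meas[OF that] HY_meas[OF that]
    show "(\<lambda>y. f (restrict (R y) (block n)) * Q 1 l y) \<in> borel_measurable M'"
      "(\<lambda>y. F y * H (Y l y)) \<in> borel_measurable M'"
      by measurable
    show "AE y in M'. f (restrict (R y) (block n)) * Q 1 l y = F y * H (Y l y)"
      using F_AE Q_AE[OF that] by eventually_elim simp
  qed
  have F_eq: "(LINT y|M'. f (restrict (R y) (block n))) = (LINT y|M'. F y)"
    by (rule integral_cong_AE) (use F_AE in auto)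
  have Q_eq: "(LINT y|M'. Q 1 2 y) = (LINT y|M'. H (Y 2 y))"
    by (rule integral_cong_AE) (use Q_meas HY_meas Q_AE in auto)
  have "(\<Sum>l\<in>{2..n}. LINT y|M'. f (restrict (R y) (block n)) * Q 1 l y) =
      (\<Sum>l\<in>{2..n}. LINT y|M'. F y * H (Y l y))"
    by (rule sum.cong[OF refl], rule FQ) simp
  then show ?thesis
    using identity FQ[of "n + 1"] F_eq Q_eq by simp
qed

end
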